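(* Let $\sigma>0$, let $\mathbf{A},\mathbf{B}\in\mathcal{S}^d_{++}$, $\mathbf{a},\mathbf{b}\in\mathbb{R}^d$, and let $\alpha=\mathcal{N}(\mathbf{a},\mathbf{A})$, $\beta=\mathcal{N}(\mathbf{b},\mathbf{B})$. Define $\mathbf{D}_\sigma=(4\mathbf{A}^{1/2}\mathbf{B}\mathbf{A}^{1/2}+\sigma^4\mathrm{Id})^{1/2}$. Then $$\mathrm{OT}_\sigma(\alpha,\beta)=\|\mathbf{a}-\mathbf{b}\|^2+\mathcal{B}^2_\sigma(\mathbf{A},\mathbf{B}),$$ where $$\mathcal{B}^2_\sigma(\mathbf{A},\mathbf{B})=\mathrm{tr}(\mathbf{A})+\mathrm{tr}(\mathbf{B})-\mathrm{tr}(\mathbf{D}_\sigma)+d\sigma^2(1-\log(2\sigma^2))+\sigma^2\log\det(\mathbf{D}_\sigma+\sigma^2\mathrm{Id}).$$ Moreover, with $\mathbf{C}_\sigma=\tfrac12\mathbf{A}^{1/2}\mathbf{D}_\sigma\mathbf{A}^{-1/2}-\tfrac{\sigma^2}{2}\mathrm{Id}$, the optimal plan $\pi^\star$ (the minimizer in the definition of $\mathrm{OT}_\sigma(\alpha,\beta)$) is the Gaussian measure on $\mathbb{R}^d\times\mathbb{R}^d$ $$\pi^\star=\mathcal{N}\left(\begin{pmatrix}\mathbf{a}\\ \mathbf{b}\end{pmatrix},\begin{pmatrix}\mathbf{A}&\mathbf{C}_\sigma\\ \mathbf{C}_\sigma^\top&\mathbf{B}\end{pmatrix}\right).$$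
   Context: $\mathcal{S}^d_{++}$ is the set of symmetric positive definite $d\times d$ real matrices; $\mathcal{N}(\mathbf{a},\mathbf{A})$ is the Gaussian law on $\mathbb{R}^d$ with mean $\mathbf{a}$ and covariance $\mathbf{A}$. For probability measures $\alpha,\beta$ on $\mathbb{R}^d$ with finite second moments, $\Pi(\alpha,\beta)$ is the set of probability measures on $\mathbb{R}^d\times\mathbb{R}^d$ with marginals $\alpha$ and $\beta$, and $$\mathrm{OT}_\sigma(\alpha,\beta)=\min_{\pi\in\Pi(\alpha,\beta)}\int\|x-y\|^2\,d\pi(x,y)+2\sigma^2\,\mathrm{KL}(\pi\|\alpha\otimes\beta),\qquad \mathrm{KL}(\pi\|\alpha\otimes\beta)=\int\log\Big(\frac{d\pi}{d\alpha\,d\beta}\Big)d\pi$$ ($+\infty$ if $\pi$ is not absolutely continuous with respect to $\alpha\otimes\beta$). *)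

theory Defs
  imports "HOL-Probability.Probability"
begin

definition pos_def :: "real^'n^'n \<Rightarrow> bool" where
  "pos_def M \<longleftrightarrow> transpose M = M \<and> (\<forall>x. x \<noteq> 0 \<longrightarrow> 0 < x \<bullet> (M *v x))"

definition pos_semidef :: "real^'n^'n \<Rightarrow> bool" where
  "pos_semidef M \<longleftrightarrow> transpose M = M \<and> (\<forall>x. 0 \<le> x \<bullet> (M *v x))"

text \<open>Principal square root; meaningful only for positive semidefinite arguments.\<close>
definition msqrt :: "real^'n^'n \<Rightarrow> real^'n^'n" where
  "msqrt M = (THE S. pos_semidef S \<and> S ** S = M)"

text \<open>
  The non-degenerate Gaussian law, given by its Lebesgue density; meaningful only for positive
  definite \<open>S\<close> (for singular \<open>S\<close> it is the zero measure, for indefinite \<open>S\<close> it is not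
  a probability measure).
\<close>
definition gaussian :: "real^'n \<Rightarrow> real^'n^'n \<Rightarrow> (real^'n) measure" where
  "gaussian m S = density lborel (\<lambda>x. ennreal
     (exp (- ((x - m) \<bullet> (matrix_inv S *v (x - m))) / 2) / sqrt ((2 * pi) ^ CARD('n) * det S)))"

definition join_vec :: "real^'m \<Rightarrow> real^'n \<Rightarrow> real^('m + 'n)" where
  "join_vec x y = (\<chi> k. case k of Inl i \<Rightarrow> x $ i | Inr j \<Rightarrow> y $ j)"

definition split_vec :: "real^('m + 'n) \<Rightarrow> (real^'m) \<times> (real^'n)" where
  "split_vec z = ((\<chi> i. z $ Inl i), (\<chi> j. z $ Inr j))"

text \<open>The block matrix with rows \<open>(P Q)\<close> and \<open>(R S)\<close>.\<close>
definition block_mat ::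
  "real^'m^'m \<Rightarrow> real^'n^'m \<Rightarrow> real^'m^'n \<Rightarrow> real^'n^'n \<Rightarrow> real^('m + 'n)^('m + 'n)" where
  "block_mat P Q R S = (\<chi> k l.
     case k of
       Inl i \<Rightarrow> (case l of Inl i' \<Rightarrow> P $ i $ i' | Inr j' \<Rightarrow> Q $ i $ j')
     | Inr j \<Rightarrow> (case l of Inl i' \<Rightarrow> R $ j $ i' | Inr j' \<Rightarrow> S $ j $ j'))"

text \<open>
  Gaussian law on a product space, with mean and covariance given in block form on the
  coordinates indexed by the sum type.
\<close>
definition gaussian_prod ::
  "real^('m + 'n) \<Rightarrow> real^('m + 'n)^('m + 'n) \<Rightarrow> ((real^'m) \<times> (real^'n)) measure" where
  "gaussian_prod m S = distr (gaussian m S) borel split_vec"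

definition couplings ::
  "'a::second_countable_topology measure \<Rightarrow> 'b::second_countable_topology measure
     \<Rightarrow> ('a \<times> 'b) measure set" where
  "couplings \<alpha> \<beta> = {\<pi>. prob_space \<pi> \<and> sets \<pi> = sets borel \<and>
     distr \<pi> borel fst = \<alpha> \<and> distr \<pi> borel snd = \<beta>}"

text \<open>
  Extended-valued relative entropy of \<open>\<pi>\<close> with respect to \<open>\<mu>\<close> (note the order of the
  arguments of \<^const>\<open>KL_divergence\<close>). For probability measures the negative part of
  \<open>log (d\<pi>/d\<mu>)\<close> is always \<open>\<pi>\<close>-integrable, so in the non-integrable case the
  integral is indeed \<open>+\<infinity>\<close>.
\<close>
definition KL :: "'a measure \<Rightarrow> 'a measure \<Rightarrow> ereal" where
  "KL \<pi> \<mu> =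
     (if absolutely_continuous \<mu> \<pi> \<and> integrable \<pi> (entropy_density (exp 1) \<mu> \<pi>)
      then ereal (KL_divergence (exp 1) \<mu> \<pi>) else \<infinity>)"

definition OT_objective :: "real \<Rightarrow> 'a::euclidean_space measure \<Rightarrow> 'a measure
    \<Rightarrow> ('a \<times> 'a) measure \<Rightarrow> ereal" where
  "OT_objective \<sigma> \<alpha> \<beta> \<pi> =
     enn2ereal (\<integral>\<^sup>+ z. ennreal ((norm (fst z - snd z))\<^sup>2) \<partial>\<pi>)
       + ereal (2 * \<sigma>\<^sup>2) * KL \<pi> (\<alpha> \<Otimes>\<^sub>M \<beta>)"

definition OT :: "real \<Rightarrow> 'a::euclidean_space measure \<Rightarrow> 'a measure \<Rightarrow> ereal" where
  "OT \<sigma> \<alpha> \<beta> = (INF \<pi>\<in>couplings \<alpha> \<beta>. OT_objective \<sigma> \<alpha> \<beta> \<pi>)"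

definition optimal_plans :: "real \<Rightarrow> 'a::euclidean_space measure \<Rightarrow> 'a measure
    \<Rightarrow> ('a \<times> 'a) measure set" where
  "optimal_plans \<sigma> \<alpha> \<beta> =
     {\<pi> \<in> couplings \<alpha> \<beta>. \<forall>\<rho>\<in>couplings \<alpha> \<beta>. OT_objective \<sigma> \<alpha> \<beta> \<pi> \<le> OT_objective \<sigma> \<alpha> \<beta> \<rho>}"

definition D_mat :: "real \<Rightarrow> real^'d^'d \<Rightarrow> real^'d^'d \<Rightarrow> real^'d^'d" where
  "D_mat \<sigma> A B = msqrt (4 *\<^sub>R (msqrt A ** B ** msqrt A) + \<sigma> ^ 4 *\<^sub>R mat 1)"

definition C_mat :: "real \<Rightarrow> real^'d^'d \<Rightarrow> real^'d^'d \<Rightarrow> real^'d^'d" where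
  "C_mat \<sigma> A B = (1 / 2) *\<^sub>R (msqrt A ** D_mat \<sigma> A B ** matrix_inv (msqrt A))
     - (\<sigma>\<^sup>2 / 2) *\<^sub>R mat 1"

definition bures_sq :: "real \<Rightarrow> real^'d^'d \<Rightarrow> real^'d^'d \<Rightarrow> real" where
  "bures_sq \<sigma> A B = trace A + trace B - trace (D_mat \<sigma> A B)
     + real CARD('d) * \<sigma>\<^sup>2 * (1 - ln (2 * \<sigma>\<^sup>2))
     + \<sigma>\<^sup>2 * ln (det (D_mat \<sigma> A B + \<sigma>\<^sup>2 *\<^sub>R mat 1))"

end

theory Submission
  imports Defs
begin

text \<open>
  The argument is duality with explicit potentials. Write \<open>s = \<sigma>\<^sup>2\<close> and let \<open>R\<close> be the density of the
  claimed plan with respect to \<open>\<alpha> \<otimes> \<beta>\<close>. It has the form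
  \<open>2 s ln R(x, y) = f(x) + g(y) - |x - y|\<^sup>2\<close> with quadratic functions \<open>f\<close> and \<open>g\<close>: the off-diagonal blocks
  of the inverse of the claimed covariance matrix are \<open>- 1 / s\<close> times the identity. For any coupling \<open>\<pi>\<close> of finite
  entropy the transport cost plus \<open>2 s \<integral> ln R d\<pi>\<close> is then \<open>(\<integral> f d\<alpha>) + (\<integral> g d\<beta>)\<close>, a constant, so that the
  objective at \<open>\<pi>\<close> equals this constant plus \<open>2 s\<close> times the relative entropy of \<open>\<pi>\<close> with respect to the claimed
  plan. Gibbs' inequality gives both the value and the uniqueness of the minimizer
  (\<open>entropic_potentials_optimal\<close>).

  What remains is Gaussian calculus. With \<open>S\<close> the square root of \<open>A\<close>, \<open>E = (D - s) / 2\<close> and \<open>F = (D + s) / 2\<close>,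
  the definition of \<open>D\<close> says that \<open>E\<close> and \<open>F = E + s\<close> commute with product \<open>S B S\<close>. The covariance matrix
  with off-diagonal block \<open>C = S E S\<^sup>-\<^sup>1\<close> has an inverse with diagonal blocks \<open>P = S\<^sup>-\<^sup>1 F S\<^sup>-\<^sup>1 / s\<close> and
  \<open>Q = S E\<^sup>-\<^sup>1 S / s\<close>, whose Schur complements are \<open>A\<^sup>-\<^sup>1\<close> and \<open>B\<^sup>-\<^sup>1\<close>. Completing the square therefore shows that the
  marginals of the plan are \<open>\<alpha>\<close> and \<open>\<beta>\<close> (\<open>tilt_coupling\<close>), and that the plan is the claimed Gaussian measure
  (\<open>gaussian_prod_eq_tilt\<close>). The integrals of \<open>f\<close> and \<open>g\<close> are traces (\<open>gaussian_quadratic_moment\<close>), and the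
  normalizing factor of \<open>R\<close>, computed from \<open>det A * det P = det F / s\<^sup>d\<close>, supplies the logarithm of the determinant.

  The groundwork is the spectral theorem for symmetric matrices, from which existence and uniqueness of
  the square root follow (\<open>psd_sqrt_exists\<close>, \<open>psd_sqrt_unique\<close>), and the linear change of variables
  for Lebesgue measure (\<open>nn_integral_lborel_affine\<close>), which makes every non-degenerate Gaussian
  law an affine image of the standard one (\<open>gaussian_affine\<close>).
\<close>

section \<open>Spectral theorem and square roots of matrices\<close>

lemma inner_matrix_symmetric:
  fixes M :: "real^'n^'n"
  assumes "transpose M = M"
  shows "x \<bullet> (M *v y) = (M *v x) \<bullet> y"
  by (metis assms dot_lmul_matrix vector_transpose_matrix)

lemma symmetric_matrix_iff:
  fixes M :: "real^'n^'n"
  shows "transpose M = M \<longleftrightarrow> (\<forall>x y. x \<bullet> (M *v y) = (M *v x) \<bullet> y)"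
proof
  assume *: "\<forall>x y. x \<bullet> (M *v y) = (M *v x) \<bullet> y"
  have "transpose M *v x = M *v x" for x
  proof -
    have "y \<bullet> (transpose M *v x) = y \<bullet> (M *v x)" for y
      by (metis * dot_lmul_matrix inner_commute vector_transpose_matrix transpose_transpose)
    then show ?thesis using vector_eq_ldot by blast
  qed
  then show "transpose M = M" by (simp add: matrix_eq)
qed (simp add: inner_matrix_symmetric)

text \<open>First-order condition at the minimum \<open>t = 0\<close> of a quadratic polynomial.\<close>

lemma linear_coeff_zero_if_nonneg:
  fixes p q :: real
  assumes "\<And>t. 0 \<le> 2 * t * p + t\<^sup>2 * q"
  shows "p = 0"
proof (rule ccontr)
  assume p: "p \<noteq> 0"
  \<comment> \<open>The minimizer of the polynomial with \<open>\<bar>q\<bar> + 1\<close> in place of \<open>q\<close>; the \<open>+ 1\<close> avoids division by zero.\<close>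
  define t where "t = - p / (\<bar>q\<bar> + 1)"
  have "2 * t * p + t\<^sup>2 * q \<le> 2 * t * p + t\<^sup>2 * (\<bar>q\<bar> + 1)"
    by (intro add_left_mono mult_left_mono) auto
  also have "\<dots> = - (p\<^sup>2 / (\<bar>q\<bar> + 1))"
    by (simp add: t_def power2_eq_square divide_simps)
  also have "\<dots> < 0" using p by (simp add: add_nonneg_pos)
  finally show False using assms[of t] by simp
qed

text \<open>Rayleigh quotient: the minimum of \<open>x \<bullet> M x\<close> over the unit sphere of an invariant subspace is
  attained, and any minimizer is an eigenvector for the least eigenvalue there.\<close>

lemma symmetric_min_eigenvector:
  fixes M :: "real^'n^'n"
  assumes sym: "transpose M = M" and U: "subspace U" "U \<noteq> {0}"
    and inv: "\<And>x. x \<in> U \<Longrightarrow> M *v x \<in> U"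
  obtains v c where "v \<in> U" "norm v = 1" "M *v v = c *\<^sub>R v"
    "\<And>x. x \<in> U \<Longrightarrow> c * (x \<bullet> x) \<le> x \<bullet> (M *v x)"
proof -
  let ?K = "sphere 0 1 \<inter> U"
  have "compact ?K" using U by (intro compact_Int_closed closed_subspace) auto
  moreover have "?K \<noteq> {}"
  proof -
    obtain u where "u \<in> U" "u \<noteq> 0" using U subspace_0 by blast
    then have "(1 / norm u) *\<^sub>R u \<in> ?K" using U(1) by (simp add: subspace_mul)
    then show ?thesis by blast
  qed
  moreover have "continuous_on ?K (\<lambda>x. x \<bullet> (M *v x))"
    by (intro continuous_intros linear_continuous_on matrix_vector_mul_bounded_linear)
  ultimately obtain v where v: "v \<in> ?K" and min: "\<And>y. y \<in> ?K \<Longrightarrow> v \<bullet> (M *v v) \<le> y \<bullet> (M *v y)"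
    using continuous_attains_inf[of ?K "\<lambda>x. x \<bullet> (M *v x)"] by metis
  define c where "c = v \<bullet> (M *v v)"
  have v1: "norm v = 1" "v \<in> U" using v by auto
  have bound: "c * (x \<bullet> x) \<le> x \<bullet> (M *v x)" if "x \<in> U" for x
  proof (cases "x = 0")
    case False
    then have "(1 / norm x) *\<^sub>R x \<in> ?K" using U(1) that by (simp add: subspace_mul)
    from min[OF this] have "c \<le> (x \<bullet> (M *v x)) / (norm x * norm x)"
      by (simp add: c_def matrix_vector_mult_scaleR)
    then show ?thesis using False
      by (simp add: pos_le_divide_eq dot_square_norm power2_eq_square)
  qed simp
  have vv: "v \<bullet> v = 1" using v1 by (simp add: dot_square_norm)
  define w where "w = M *v v - c *\<^sub>R v"
  have w: "w \<in> U" using U inv v1 by (auto simp: w_def intro: subspace_diff subspace_mul)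
  have "w \<bullet> (M *v v) - c * (w \<bullet> v) = 0"
  proof (rule linear_coeff_zero_if_nonneg)
    fix t :: real
    have "v + t *\<^sub>R w \<in> U" using U w v1 by (auto intro: subspace_add subspace_mul)
    from bound[OF this] show "0 \<le> 2 * t * (w \<bullet> (M *v v) - c * (w \<bullet> v))
        + t\<^sup>2 * (w \<bullet> (M *v w) - c * (w \<bullet> w))"
      using inner_matrix_symmetric[OF sym, of v w] vv
      by (simp add: c_def matrix_vector_right_distrib matrix_vector_mult_scaleR algebra_simps
          inner_simps power2_eq_square inner_commute)
  qed
  then have "w \<bullet> w = 0" by (simp add: w_def inner_simps)
  then have "M *v v = c *\<^sub>R v" by (simp add: w_def)
  with that v1 bound show ?thesis by blast
qed

text \<open>Spectral theorem, by induction on the dimension: split off one eigenvector and pass to its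
  orthogonal complement in \<open>U\<close>, which is again invariant.\<close>

lemma symmetric_eigenbasis_subspace:
  fixes M :: "real^'n^'n"
  assumes sym: "transpose M = M" and "subspace U" and "\<And>x. x \<in> U \<Longrightarrow> M *v x \<in> U"
  shows "\<exists>Bs l. finite Bs \<and> span Bs = U \<and> pairwise orthogonal Bs \<and>
    (\<forall>b\<in>Bs. norm b = 1 \<and> M *v b = l b *\<^sub>R b)"
  using assms(2-)
proof (induction "dim U" arbitrary: U rule: less_induct)
  case less
  show ?case
  proof (cases "U = {0}")
    case True
    then show ?thesis by (intro exI[of _ "{}"]) auto
  next
    case False
    obtain v c where v: "v \<in> U" "norm v = 1" "M *v v = c *\<^sub>R v"
      using symmetric_min_eigenvector[OF sym less.prems(1) False less.prems(2)] by metis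
    define W where "W = U \<inter> {x. v \<bullet> x = 0}"
    have W: "subspace W" unfolding W_def
      by (intro subspace_inter less.prems subspace_hyperplane)
    have inv: "M *v x \<in> W" if "x \<in> W" for x
      using that less.prems v by (auto simp: W_def inner_matrix_symmetric[OF sym])
    have "dim W < dim U"
    proof (rule dim_psubset)
      have "v \<in> U - W" using v by (auto simp: W_def)
      moreover have "W \<subseteq> U" by (auto simp: W_def)
      ultimately show "span W \<subset> span U" using W less.prems
        by (auto simp: span_eq_iff[THEN iffD2])
    qed
    from less.hyps[OF this W inv] obtain Bs l where Bs: "finite Bs" "span Bs = W"
      "pairwise orthogonal Bs" "\<forall>b\<in>Bs. norm b = 1 \<and> M *v b = l b *\<^sub>R b" by blast
    have BW: "Bs \<subseteq> W" using Bs(2) span_superset by blast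
    have vB: "v \<notin> Bs" using BW v by (auto simp: W_def)
    have "span (insert v Bs) = U"
    proof
      show "span (insert v Bs) \<subseteq> U"
        using BW v less.prems by (intro span_minimal) (auto simp: W_def)
      show "U \<subseteq> span (insert v Bs)"
      proof
        fix x assume x: "x \<in> U"
        have "x - (v \<bullet> x) *\<^sub>R v \<in> W"
          using x v less.prems by (auto simp: W_def inner_simps dot_square_norm
              intro: subspace_diff subspace_mul)
        then show "x \<in> span (insert v Bs)" using Bs(2) unfolding span_insert by blast
      qed
    qed
    moreover have "pairwise orthogonal (insert v Bs)"
      using Bs(3) BW unfolding pairwise_insert
      by (auto simp: W_def orthogonal_def inner_commute)
    moreover have "\<forall>b\<in>insert v Bs. norm b = 1 \<and> M *v b = (l(v := c)) b *\<^sub>R b"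
      using Bs(4) v vB by auto
    ultimately show ?thesis using Bs(1) by blast
  qed
qed

lemma symmetric_eigenbasis:
  fixes M :: "real^'n^'n"
  assumes "transpose M = M"
  obtains Bs l where "finite Bs" "span Bs = UNIV" "pairwise orthogonal Bs"
    "\<And>b. b \<in> Bs \<Longrightarrow> norm b = 1" "\<And>b. b \<in> Bs \<Longrightarrow> M *v b = l b *\<^sub>R b"
  using symmetric_eigenbasis_subspace[OF assms subspace_UNIV] by (metis UNIV_I)

lemma matrix_eqI_span:
  fixes M N :: "real^'n^'m"
  assumes "span Bs = UNIV" "\<And>b. b \<in> Bs \<Longrightarrow> M *v b = N *v b"
  shows "M = N"
  unfolding matrix_eq
  using linear_eq_on_span[of "(*v) M" "(*v) N" Bs] assms by simp

lemma psd_sqrt_exists: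
  fixes M :: "real^'n^'n"
  assumes "pos_semidef M"
  shows "\<exists>S. pos_semidef S \<and> S ** S = M"
proof -
  have sym: "transpose M = M" and psd: "\<And>x. 0 \<le> x \<bullet> (M *v x)"
    using assms by (auto simp: pos_semidef_def)
  obtain Bs l where Bs: "finite Bs" "span Bs = UNIV" "pairwise orthogonal Bs"
    "\<And>b. b \<in> Bs \<Longrightarrow> norm b = 1" "\<And>b. b \<in> Bs \<Longrightarrow> M *v b = l b *\<^sub>R b"
    using symmetric_eigenbasis[OF sym] by metis
  have l: "0 \<le> l b" if "b \<in> Bs" for b
    using psd[of b] Bs(4,5)[OF that] by (simp add: dot_square_norm)
  define f where "f x = (\<Sum>b\<in>Bs. (sqrt (l b) * (b \<bullet> x)) *\<^sub>R b)" for x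
  have lin: "linear f" unfolding f_def
    by (intro linear_compose_sum) (auto simp: linear_iff inner_simps algebra_simps)
  define S where "S = matrix f"
  have S: "S *v x = f x" for x by (simp add: S_def matrix_works lin)
  have "f b = sqrt (l b) *\<^sub>R b" if "b \<in> Bs" for b
  proof -
    have "f b = (\<Sum>b'\<in>Bs. if b' = b then sqrt (l b) *\<^sub>R b else 0)"
      unfolding f_def using Bs(3,4) that
      by (intro sum.cong) (auto simp: dot_square_norm pairwise_def orthogonal_def)
    then show ?thesis using Bs(1) that by simp
  qed
  then have "(S ** S) *v b = M *v b" if "b \<in> Bs" for b
    using that l Bs(5)
    by (simp add: matrix_vector_mul_assoc[symmetric] S linear_scale[OF lin])
  then have "S ** S = M" using matrix_eqI_span[OF Bs(2)] by blast
  moreover have "transpose S = S"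
    unfolding symmetric_matrix_iff S f_def
    by (auto simp: inner_sum_left inner_sum_right inner_commute mult_ac intro!: sum.cong)
  moreover have "0 \<le> x \<bullet> (S *v x)" for x
  proof -
    have "x \<bullet> (S *v x) = (\<Sum>b\<in>Bs. sqrt (l b) * (b \<bullet> x)\<^sup>2)"
      unfolding S f_def
      by (auto simp: inner_sum_right inner_commute power2_eq_square intro!: sum.cong)
    then show ?thesis using l by (auto intro!: sum_nonneg)
  qed
  ultimately show ?thesis by (auto simp: pos_semidef_def)
qed

lemma psd_sqrt_unique:
  fixes S T :: "real^'n^'n"
  assumes "pos_semidef S" "pos_semidef T" "S ** S = T ** T"
  shows "S = T"
proof -
  \<comment> \<open>A positive semidefinite root of \<open>T ** T\<close> acts on each eigenvector of \<open>T\<close> by the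
    same eigenvalue.\<close>
  obtain Bs l where Bs: "span Bs = UNIV"
    "\<And>b. b \<in> Bs \<Longrightarrow> norm b = 1" "\<And>b. b \<in> Bs \<Longrightarrow> T *v b = l b *\<^sub>R b"
    using symmetric_eigenbasis[of T] assms(2) unfolding pos_semidef_def by metis
  have "S *v b = T *v b" if b: "b \<in> Bs" for b
  proof -
    have l0: "0 \<le> l b"
      using assms(2) Bs(2,3)[OF b] unfolding pos_semidef_def
      by (metis dot_square_norm inner_scaleR_right mult.right_neutral one_power2)
    have SS: "S *v (S *v b) = (l b)\<^sup>2 *\<^sub>R b"
      by (metis Bs(3)[OF b] assms(3) matrix_vector_mul_assoc matrix_vector_mult_scaleR
          power2_eq_square scaleR_scaleR)
    define w where "w = S *v b - l b *\<^sub>R b"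
    have Sw: "S *v w = - l b *\<^sub>R w"
      by (simp add: w_def matrix_vector_mult_diff_distrib SS matrix_vector_mult_scaleR
          algebra_simps power2_eq_square)
    have "0 \<le> w \<bullet> (S *v w)" using assms(1) by (simp add: pos_semidef_def)
    then have "l b * (w \<bullet> w) \<le> 0" by (simp add: Sw)
    then have "l b = 0 \<or> w = 0" using l0
      by (metis inner_eq_zero_iff inner_ge_zero mult_eq_0_iff mult_nonneg_nonneg order_antisym)
    moreover have "w = 0" if "l b = 0"
    proof -
      have "w \<bullet> w = b \<bullet> (S *v (S *v b))"
        using that assms(1) by (simp add: w_def pos_semidef_def inner_matrix_symmetric)
      then show ?thesis using that SS by simp
    qed
    ultimately show ?thesis using Bs(3)[OF b] by (auto simp: w_def)
  qed
  then show ?thesis using matrix_eqI_span[OF Bs(1)] by blast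
qed

lemma msqrt_unique:
  assumes "pos_semidef S" "S ** S = M"
  shows "msqrt M = S"
  unfolding msqrt_def using assms psd_sqrt_unique by (intro the_equality) auto

lemma pos_def_imp_psd: "pos_def M \<Longrightarrow> pos_semidef M"
  unfolding pos_def_def pos_semidef_def by (metis inner_zero_left less_imp_le order_refl)

lemma pos_def_invertible:
  fixes M :: "real^'n^'n"
  assumes "pos_def M" shows "invertible M"
proof -
  have "x = 0" if "M *v x = 0" for x
    using assms that by (metis pos_def_def inner_zero_right less_irrefl)
  then show ?thesis
    by (simp add: invertible_left_inverse matrix_left_invertible_ker)
qed

lemma msqrt_pos_def:
  fixes M :: "real^'n^'n"
  assumes "pos_def M"
  shows "pos_def (msqrt M)" "msqrt M ** msqrt M = M"
proof -
  obtain S where S: "pos_semidef S" "S ** S = M"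
    using psd_sqrt_exists[OF pos_def_imp_psd[OF assms]] by blast
  then have eq: "msqrt M = S" by (rule msqrt_unique)
  then show "msqrt M ** msqrt M = M" using S by simp
  obtain v c where vc: "norm v = 1" "S *v v = c *\<^sub>R v"
      "\<And>x. c * (x \<bullet> x) \<le> x \<bullet> (S *v x)"
  proof (rule symmetric_min_eigenvector[of S UNIV])
    show "transpose S = S" using S by (simp add: pos_semidef_def)
    have "\<exists>x::real^'n. x \<noteq> 0" by (metis SOME_Basis nonzero_Basis)
    then show "(UNIV :: (real^'n) set) \<noteq> {0}" by blast
  qed auto
  have "v \<noteq> 0" using vc by auto
  \<comment> \<open>The least eigenvalue \<open>c\<close> of the root is nonnegative, and \<open>c * c\<close> is an eigenvalue of \<open>M\<close>.\<close>
  have "M *v v = (c * c) *\<^sub>R v" using S vc by (auto simp: matrix_vector_mul_assoc[symmetric] matrix_vector_mult_scaleR)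
  moreover have "0 < v \<bullet> (M *v v)" using assms \<open>v \<noteq> 0\<close> by (simp add: pos_def_def)
  ultimately have "c \<noteq> 0" by auto
  moreover have "0 \<le> v \<bullet> (S *v v)" using S by (simp add: pos_semidef_def)
  ultimately have "0 < c" using vc(1,2) by (simp add: dot_square_norm)
  then have "0 < x \<bullet> (S *v x)" if "x \<noteq> 0" for x
    using vc(3)[of x] that by (smt (verit) inner_gt_zero_iff mult_pos_pos)
  then show "pos_def (msqrt M)" using S eq by (simp add: pos_def_def pos_semidef_def)
qed

section \<open>Inverses and positive definite matrices\<close>

lemma matrix_inv_eqI:
  fixes A B :: "real^'n^'n"
  assumes "A ** B = mat 1"
  shows "matrix_inv A = B"
proof -
  have BA: "B ** A = mat 1" using assms matrix_left_right_inverse by blast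
  have "\<exists>A'. A ** A' = mat 1 \<and> A' ** A = mat 1" using assms BA by blast
  then have "matrix_inv A ** A = mat 1" unfolding matrix_inv_def by (metis (mono_tags, lifting) someI_ex)
  then show ?thesis by (metis assms matrix_mul_assoc matrix_mul_lid matrix_mul_rid)
qed

lemma invertible_matrix_inv:
  fixes A :: "real^'n^'n"
  assumes "invertible A"
  shows "A ** matrix_inv A = mat 1" "matrix_inv A ** A = mat 1"
proof -
  obtain B where "A ** B = mat 1" "B ** A = mat 1" using assms by (auto simp: invertible_def)
  then show "A ** matrix_inv A = mat 1" "matrix_inv A ** A = mat 1"
    using matrix_inv_eqI by metis+
qed

lemma transpose_matrix_inv:
  fixes A :: "real^'n^'n"
  assumes "invertible A"
  shows "transpose (matrix_inv A) = matrix_inv (transpose A)"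
proof -
  have "transpose A ** transpose (matrix_inv A) = mat 1"
    using invertible_matrix_inv[OF assms] by (metis matrix_transpose_mul transpose_mat)
  from matrix_inv_eqI[OF this] show ?thesis by simp
qed

lemma matrix_inv_mat_1 [simp]: "matrix_inv (mat 1 :: real^'n^'n) = mat 1"
  by (rule matrix_inv_eqI) simp

lemma det_pos_def_nz: "pos_def M \<Longrightarrow> det M \<noteq> 0"
  using pos_def_invertible invertible_det_nz by blast

lemma det_pos_def_pos:
  fixes M :: "real^'n^'n"
  assumes "pos_def M" shows "0 < det M"
proof -
  have "det M = (det (msqrt M))\<^sup>2"
    using msqrt_pos_def(2)[OF assms] by (metis det_mul power2_eq_square)
  then show ?thesis using det_pos_def_nz[OF assms] by (metis zero_less_power2 power_zero_numeral)
qed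

lemma pos_def_matrix_inv:
  fixes M :: "real^'n^'n"
  assumes "pos_def M" shows "pos_def (matrix_inv M)" "matrix_inv (matrix_inv M) = M"
proof -
  note inv = invertible_matrix_inv[OF pos_def_invertible[OF assms]]
  show "matrix_inv (matrix_inv M) = M" by (rule matrix_inv_eqI) (rule inv)
  have "transpose (matrix_inv M) = matrix_inv M"
    using transpose_matrix_inv[OF pos_def_invertible[OF assms]] assms by (simp add: pos_def_def)
  moreover have "0 < x \<bullet> (matrix_inv M *v x)" if "x \<noteq> 0" for x
  proof -
    let ?y = "matrix_inv M *v x"
    have x: "M *v ?y = x" by (simp add: matrix_vector_mul_assoc inv)
    then have "?y \<noteq> 0" using that by auto
    then have "0 < ?y \<bullet> (M *v ?y)" using assms by (simp add: pos_def_def)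
    then show ?thesis by (simp add: x inner_commute)
  qed
  ultimately show "pos_def (matrix_inv M)" by (simp add: pos_def_def)
qed

lemma det_scaleR:
  fixes M :: "real^'n^'n"
  shows "det (r *\<^sub>R M) = r ^ CARD('n) * det M"
proof -
  have "r *\<^sub>R M = (r *\<^sub>R mat 1) ** M" by (metis scalar_matrix_assoc matrix_mul_lid)
  moreover have "det (r *\<^sub>R mat 1 :: real^'n^'n) = r ^ CARD('n)"
    by (subst det_diagonal) (auto simp: mat_def)
  ultimately show ?thesis by (simp add: det_mul)
qed

lemma pos_def_congruence:
  fixes M S :: "real^'n^'n"
  assumes "pos_def M" "transpose S = S" "invertible S"
  shows "pos_def (S ** M ** S)"
proof -
  have "transpose (S ** M ** S) = S ** M ** S"
    using assms by (simp add: pos_def_def matrix_transpose_mul matrix_mul_assoc)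
  moreover have "0 < x \<bullet> ((S ** M ** S) *v x)" if "x \<noteq> 0" for x
  proof -
    have "S *v x \<noteq> 0" using that invertible_matrix_inv(2)[OF assms(3)]
      by (metis matrix_vector_mul_assoc matrix_vector_mul_lid matrix_vector_mult_0_right)
    then have "0 < (S *v x) \<bullet> (M *v (S *v x))" using assms(1) by (simp add: pos_def_def)
    then show ?thesis
      by (simp add: matrix_vector_mul_assoc[symmetric] inner_matrix_symmetric[OF assms(2)])
  qed
  ultimately show ?thesis by (simp add: pos_def_def)
qed

lemma pos_def_scaleR:
  assumes "pos_def M" "0 < r" shows "pos_def (r *\<^sub>R M)"
  using assms by (simp add: pos_def_def transpose_scalar scaleR_matrix_vector_assoc[symmetric])

lemma pos_def_add_psd:
  assumes "pos_def M" "pos_semidef N" shows "pos_def (M + N)"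
proof -
  have "transpose (M + N) = M + N"
    using assms by (simp add: pos_def_def pos_semidef_def transpose_def vec_eq_iff)
  then show ?thesis using assms
    by (simp add: pos_def_def pos_semidef_def matrix_vector_mult_add_rdistrib inner_add_right add_pos_nonneg)
qed

lemma pos_def_scaled_identity: "0 < r \<Longrightarrow> pos_def (r *\<^sub>R mat 1 :: real^'n^'n)"
  by (rule pos_def_scaleR) (simp_all add: pos_def_def)

lemma trace_scaleR: "trace (r *\<^sub>R M) = r * trace (M :: real^'n^'n)"
  by (simp add: trace_def sum_distrib_left)

text \<open>The least eigenvalue \<open>\<mu>\<close> of \<open>E\<close> satisfies \<open>\<mu> (\<mu> + s) > 0\<close> and \<open>\<mu> \<ge> - s / 2\<close>, which excludes
  \<open>\<mu> < - s\<close> and leaves \<open>\<mu> > 0\<close>.\<close>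

lemma pos_def_of_shifted_square:
  fixes E X :: "real^'n^'n"
  assumes sym: "transpose E = E" and X: "pos_def X" and eq: "E ** (E + s *\<^sub>R mat 1) = X"
    and lower: "pos_semidef (E + (s / 2) *\<^sub>R mat 1)" and s: "0 < s"
  shows "pos_def E"
proof -
  obtain v \<mu> where v: "norm v = 1" "E *v v = \<mu> *\<^sub>R v"
      and min: "\<And>x. \<mu> * (x \<bullet> x) \<le> x \<bullet> (E *v x)"
  proof (rule symmetric_min_eigenvector[of E UNIV])
    show "transpose E = E" by (rule sym)
    have "\<exists>x::real^'n. x \<noteq> 0" by (metis SOME_Basis nonzero_Basis)
    then show "(UNIV :: (real^'n) set) \<noteq> {0}" by blast
  qed auto
  have vv: "v \<bullet> v = 1" using v by (simp add: dot_square_norm)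
  have "X *v v = (\<mu> * (\<mu> + s)) *\<^sub>R v"
    unfolding eq[symmetric]
    by (simp add: matrix_vector_mul_assoc[symmetric] matrix_vector_mult_add_rdistrib v
        scaleR_matrix_vector_assoc[symmetric] matrix_vector_right_distrib matrix_vector_mult_scaleR algebra_simps)
  moreover have "v \<noteq> 0" using v by auto
  then have "0 < v \<bullet> (X *v v)" using X by (simp add: pos_def_def)
  ultimately have pos: "0 < \<mu> * (\<mu> + s)" by (simp add: vv)
  have "0 \<le> v \<bullet> ((E + (s / 2) *\<^sub>R mat 1) *v v)" using lower by (simp add: pos_semidef_def)
  then have "- s / 2 \<le> \<mu>"
    by (simp add: matrix_vector_mult_add_rdistrib v scaleR_matrix_vector_assoc[symmetric] inner_add_right vv)
  then have "0 < \<mu>" using pos s by (auto simp: zero_less_mult_iff)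
  then have "0 < x \<bullet> (E *v x)" if "x \<noteq> 0" for x
    using min[of x] that by (smt (verit) inner_gt_zero_iff mult_pos_pos)
  then show ?thesis using sym by (simp add: pos_def_def)
qed

section \<open>Linear change of variables for Lebesgue measure\<close>

text \<open>Invariance of Lebesgue measure under a shear: for all other coordinates fixed, the shear is a
  translation in direction \<open>b\<close>, so Fubini applies.\<close>

lemma nn_integral_lborel_shear:
  fixes h :: "'a::euclidean_space \<Rightarrow> ennreal"
  assumes b: "b \<in> Basis" "b' \<in> Basis" "b \<noteq> b'" and h[measurable]: "h \<in> borel_measurable borel"
  shows "(\<integral>\<^sup>+x. h (x + (c * (x \<bullet> b')) *\<^sub>R b) \<partial>lborel) = (\<integral>\<^sup>+x. h x \<partial>lborel)"
proof -
  interpret product_sigma_finite "\<lambda>_::'a. lborel :: real measure" by standard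
  let ?v = "\<lambda>f::'a \<Rightarrow> real. \<Sum>b\<in>Basis. f b *\<^sub>R b"
  let ?w = "\<lambda>f::'a \<Rightarrow> real. \<Sum>b\<in>Basis - {b}. f b *\<^sub>R b"
  have lb: "(\<integral>\<^sup>+x. g x \<partial>lborel) =
      (\<integral>\<^sup>+f. (\<integral>\<^sup>+y. g (y *\<^sub>R b + ?w f) \<partial>lborel) \<partial>PiM (Basis - {b}) (\<lambda>_. lborel))"
    if [measurable]: "g \<in> borel_measurable borel" for g :: "'a \<Rightarrow> ennreal"
  proof -
    have ins: "insert b (Basis - {b}) = Basis" using b by auto
    have "(\<integral>\<^sup>+x. g x \<partial>lborel) = (\<integral>\<^sup>+f. g (?v f) \<partial>PiM Basis (\<lambda>_. lborel))"
      by (simp add: lborel_def[where 'a='a] lborel_eq_real[symmetric] nn_integral_distr)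
    also have "\<dots> = (\<integral>\<^sup>+f. g (?v f) \<partial>PiM (insert b (Basis - {b})) (\<lambda>_. lborel))"
      by (simp only: ins)
    also have "\<dots> = (\<integral>\<^sup>+f. (\<integral>\<^sup>+y. g (?v (f(b := y))) \<partial>lborel) \<partial>PiM (Basis - {b}) (\<lambda>_. lborel))"
    proof (subst product_nn_integral_insert)
      show "(\<lambda>f. g (?v f)) \<in> borel_measurable (PiM (insert b (Basis - {b})) (\<lambda>_. lborel))"
        unfolding ins by measurable
    qed auto
    also have "\<dots> = (\<integral>\<^sup>+f. (\<integral>\<^sup>+y. g (y *\<^sub>R b + ?w f) \<partial>lborel) \<partial>PiM (Basis - {b}) (\<lambda>_. lborel))"
      using b by (simp add: sum.remove[of Basis b])
    finally show ?thesis .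
  qed
  have "(\<integral>\<^sup>+y. h (y *\<^sub>R b + ?w f + (c * ((y *\<^sub>R b + ?w f) \<bullet> b')) *\<^sub>R b) \<partial>lborel)
      = (\<integral>\<^sup>+y. h (y *\<^sub>R b + ?w f) \<partial>lborel)" for f
  proof -
    have "(y *\<^sub>R b + ?w f) \<bullet> b' = ?w f \<bullet> b'" for y
      using b by (simp add: inner_add_left inner_not_same_Basis)
    note ip = this
    have "(\<integral>\<^sup>+y. h (y *\<^sub>R b + ?w f + (c * ((y *\<^sub>R b + ?w f) \<bullet> b')) *\<^sub>R b) \<partial>lborel)
        = (\<integral>\<^sup>+y. h ((c * (?w f \<bullet> b') + y) *\<^sub>R b + ?w f) \<partial>lborel)"
      by (simp only: ip) (simp add: algebra_simps)
    also have "\<dots> = (\<integral>\<^sup>+y. h (y *\<^sub>R b + ?w f) \<partial>distr lborel borel ((+) (c * (?w f \<bullet> b'))))"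
      by (subst nn_integral_distr) auto
    also have "\<dots> = (\<integral>\<^sup>+y. h (y *\<^sub>R b + ?w f) \<partial>lborel)"
      by (simp only: lborel_distr_plus)
    finally show ?thesis .
  qed
  then show ?thesis by (simp add: lb)
qed

lemma prod_Basis_vec:
  fixes f :: "real^'n \<Rightarrow> 'b::comm_monoid_mult"
  shows "(\<Prod>b\<in>Basis. f b) = (\<Prod>i\<in>UNIV. f (axis i 1))"
proof -
  have "(Basis :: (real^'n) set) = range (\<lambda>i. axis i 1)" by (auto simp: Basis_vec_def)
  moreover have "inj (\<lambda>i::'n. axis i (1::real))" by (auto simp: inj_def axis_eq_axis)
  ultimately show ?thesis using prod.reindex[of "\<lambda>i. axis i 1" UNIV f] by (metis comp_def prod.cong)
qed

lemma lborel_distr_swap: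
  fixes m n :: "'n::finite"
  shows "distr lborel borel (\<lambda>v::real^'n. \<chi> i. v $ Transposition.transpose m n i) = lborel" (is "distr _ _ ?f = _")
proof (rule lborel_eqI[symmetric])
  fix l u :: "real^'n"
  assume lu: "\<And>b. b \<in> Basis \<Longrightarrow> l \<bullet> b \<le> u \<bullet> b"
  then have le: "l $ i \<le> u $ i" for i by (force simp: Basis_vec_def inner_axis)
  have [measurable]: "?f \<in> borel_measurable borel"
    by (intro borel_measurable_continuous_onI continuous_intros)
  have "?f -` box l u = box (?f l) (?f u)"
    by (auto simp: mem_box_cart) (metis transpose_involutory)+
  then have "emeasure (distr lborel borel ?f) (box l u) = emeasure lborel (box (?f l) (?f u))"
    by (simp add: emeasure_distr)
  also have "\<dots> = (\<Prod>b\<in>Basis. (?f u - ?f l) \<bullet> b)"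
    using le by (intro emeasure_lborel_box) (auto simp: Basis_vec_def inner_axis)
  also have "\<dots> = ennreal (\<Prod>i\<in>UNIV. (u - l) $ Transposition.transpose m n i)"
    by (simp add: prod_Basis_vec inner_axis)
  also have "\<dots> = ennreal (\<Prod>i\<in>UNIV. (u - l) $ i)"
    using prod.permute[OF permutes_swap_id[of m UNIV n], of "\<lambda>i. (u - l) $ i"]
    by (simp add: o_def)
  also have "\<dots> = (\<Prod>b\<in>Basis. (u - l) \<bullet> b)"
    by (simp add: prod_Basis_vec inner_axis)
  finally show "emeasure (distr lborel borel ?f) (box l u) = (\<Prod>b\<in>Basis. (u - l) \<bullet> b)" .
qed simp



text \<open>Linear change of variables. The claim is stable under products and holds for diagonal matrices,
  coordinate swaps and shears, hence for every invertible matrix by Gaussian elimination.\<close>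

lemma nn_integral_lborel_matrix:
  fixes A :: "real^'n^'n"
  assumes "det A \<noteq> 0" and "h \<in> borel_measurable borel"
  shows "(\<integral>\<^sup>+x. h x \<partial>lborel) = ennreal \<bar>det A\<bar> * (\<integral>\<^sup>+u. h (A *v u) \<partial>lborel)"
proof -
  have mv[measurable]: "(*v) B \<in> borel_measurable borel" for B :: "real^'n^'n"
    by (intro borel_measurable_continuous_onI linear_continuous_on matrix_vector_mul_bounded_linear)
  have "det A \<noteq> 0 \<longrightarrow> (\<forall>h\<in>borel_measurable borel.
      (\<integral>\<^sup>+x. h x \<partial>lborel) = ennreal \<bar>det A\<bar> * (\<integral>\<^sup>+u. h (A *v u) \<partial>lborel))"
  proof (induction A rule: induct_matrix_elementary)
    case (1 A B)
    show ?case
    proof (intro impI ballI)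
      fix h :: "real^'n \<Rightarrow> ennreal" assume d: "det (A ** B) \<noteq> 0" and [measurable]: "h \<in> borel_measurable borel"
      from d have "det A \<noteq> 0" "det B \<noteq> 0" by (auto simp: det_mul)
      then have "(\<integral>\<^sup>+x. h x \<partial>lborel) = ennreal \<bar>det A\<bar> * (\<integral>\<^sup>+u. h (A *v u) \<partial>lborel)"
        and "(\<integral>\<^sup>+u. h (A *v u) \<partial>lborel)
          = ennreal \<bar>det B\<bar> * (\<integral>\<^sup>+u. h (A *v (B *v u)) \<partial>lborel)"
        using 1(1)[rule_format, of h] 1(2)[rule_format, of "\<lambda>u. h (A *v u)"] by auto
      then show "(\<integral>\<^sup>+x. h x \<partial>lborel)
          = ennreal \<bar>det (A ** B)\<bar> * (\<integral>\<^sup>+u. h ((A ** B) *v u) \<partial>lborel)"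
        by (simp add: det_mul abs_mult ennreal_mult matrix_vector_mul_assoc mult.assoc)
    qed
  next
    case (2 A i)
    then show ?case by (simp add: det_zero_row)
  next
    case (3 A)
    have det: "det A = (\<Prod>i\<in>UNIV. A$i$i)" by (rule det_diagonal) (rule 3)
    have Av: "A *v u = (\<chi> i. A$i$i * u$i)" for u
    proof -
      have "(\<Sum>j\<in>UNIV. A$i$j * u$j) = (\<Sum>j\<in>UNIV. if j = i then A$i$i * u$i else 0)" for i
        using 3 by (intro sum.cong) auto
      then show ?thesis by (simp add: matrix_vector_mult_def vec_eq_iff)
    qed
    show ?case
    proof (intro impI ballI)
      fix h :: "real^'n \<Rightarrow> ennreal" assume d: "det A \<noteq> 0" and [measurable]: "h \<in> borel_measurable borel"
      define c where "c b = (A *v b) \<bullet> b" for b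
      have c: "c (axis i 1) = A$i$i" for i unfolding c_def Av inner_axis by (simp add: axis_def)
      have cnz: "c b \<noteq> 0" if "b \<in> Basis" for b
        using that d by (auto simp: Basis_vec_def c det)
      have T: "(\<lambda>x. 0 + (\<Sum>j\<in>Basis. (c j * (x \<bullet> j)) *\<^sub>R j)) = (*v) A"
      proof
        fix x :: "real^'n"
        show "0 + (\<Sum>j\<in>Basis. (c j * (x \<bullet> j)) *\<^sub>R j) = A *v x"
        proof (rule euclidean_eqI)
          fix b :: "real^'n" assume b: "b \<in> Basis"
          then obtain i where "b = axis i 1" by (auto simp: Basis_vec_def)
          have "(0 + (\<Sum>j\<in>Basis. (c j * (x \<bullet> j)) *\<^sub>R j)) \<bullet> b = c b * (x \<bullet> b)"
            using b by simp
          then show "(0 + (\<Sum>j\<in>Basis. (c j * (x \<bullet> j)) *\<^sub>R j)) \<bullet> b = (A *v x) \<bullet> b"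
            unfolding \<open>b = axis i 1\<close> by (simp add: inner_axis Av c)
        qed
      qed
      have "lborel = density (distr lborel borel ((*v) A)) (\<lambda>_. (\<Prod>j\<in>Basis. \<bar>c j\<bar>))"
        using lborel_affine_euclidean[of c 0, OF cnz] T by simp
      also have "(\<Prod>j\<in>Basis. \<bar>c j\<bar>) = \<bar>det A\<bar>"
        by (simp add: prod_Basis_vec c det abs_prod)
      finally have "(\<integral>\<^sup>+x. h x \<partial>lborel)
          = (\<integral>\<^sup>+x. h x \<partial>density (distr lborel borel ((*v) A)) (\<lambda>_. \<bar>det A\<bar>))" by simp
      then show "(\<integral>\<^sup>+x. h x \<partial>lborel) = ennreal \<bar>det A\<bar> * (\<integral>\<^sup>+u. h (A *v u) \<partial>lborel)"
        by (simp add: nn_integral_density nn_integral_distr nn_integral_cmult)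
    qed
  next
    case (4 m n)
    let ?A = "\<chi> i j. (mat 1 :: real^'n^'n) $ i $ Transposition.transpose m n j"
    have Av: "?A *v v = (\<chi> i. v $ Transposition.transpose m n i)" for v
    proof -
      have "(\<Sum>j\<in>UNIV. ?A $ i $ j * v $ j) = (\<Sum>j\<in>UNIV.
          if j = Transposition.transpose m n i then v $ Transposition.transpose m n i else 0)" for i
        by (intro sum.cong) (auto simp: mat_def)
      then show ?thesis by (simp add: matrix_vector_mult_def vec_eq_iff)
    qed
    have det: "\<bar>det ?A\<bar> = 1"
      by (simp add: det_permute_columns permutes_swap_id sign_swap_id abs_mult)
    have Av': "(*v) ?A = (\<lambda>v. \<chi> i. v $ Transposition.transpose m n i)" by (rule ext) (rule Av)
    have inv: "distr lborel borel ((*v) ?A) = lborel"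
      unfolding Av' by (rule lborel_distr_swap)
    show ?case
    proof (intro impI ballI)
      fix h :: "real^'n \<Rightarrow> ennreal" assume [measurable]: "h \<in> borel_measurable borel"
      have "(\<integral>\<^sup>+x. h x \<partial>lborel) = (\<integral>\<^sup>+x. h x \<partial>distr lborel borel ((*v) ?A))"
        by (simp only: inv)
      also have "\<dots> = (\<integral>\<^sup>+u. h (?A *v u) \<partial>lborel)"
        by (subst nn_integral_distr) auto
      finally show "(\<integral>\<^sup>+x. h x \<partial>lborel) = ennreal \<bar>det ?A\<bar> * (\<integral>\<^sup>+u. h (?A *v u) \<partial>lborel)"
        unfolding det by simp
    qed
  next
    case (5 m n c)
    let ?A = "(\<chi> i j. if i = m \<and> j = n then c else of_bool (i = j)) :: real^'n^'n"
    have eq: "?A = (\<chi> k. if k = m then row m (mat 1) + c *s row n (mat 1) else row k (mat 1))"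
      using 5 by (auto simp: vec_eq_iff row_def mat_def)
    have det: "det ?A = 1" unfolding eq det_row_operation[OF 5] by simp
    have Av: "?A *v u = u + (c * (u \<bullet> axis n 1)) *\<^sub>R axis m 1" for u
    proof -
      have "(\<Sum>j\<in>UNIV. ?A $ i $ j * u $ j) = (\<Sum>j\<in>UNIV. (if j = i then u $ i else 0)
          + (if j = n then (if i = m then c * u $ n else 0) else 0))" for i
        using 5 by (intro sum.cong) auto
      then have "(?A *v u) $ i = u $ i + (if i = m then c * u $ n else 0)" for i
        by (simp add: matrix_vector_mult_def sum.distrib)
      then show ?thesis unfolding vec_eq_iff inner_axis by (auto simp: axis_def)
    qed
    show ?case
    proof (intro impI ballI)
      fix h :: "real^'n \<Rightarrow> ennreal" assume [measurable]: "h \<in> borel_measurable borel"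
      show "(\<integral>\<^sup>+x. h x \<partial>lborel) = ennreal \<bar>det ?A\<bar> * (\<integral>\<^sup>+u. h (?A *v u) \<partial>lborel)"
        unfolding det Av using 5 nn_integral_lborel_shear[of "axis m 1 :: real^'n" "axis n 1" h c]
        by (simp add: axis_in_Basis_iff axis_eq_axis)
    qed
  qed
  then show ?thesis using assms by blast
qed

lemma nn_integral_lborel_affine:
  fixes A :: "real^'n^'n"
  assumes "det A \<noteq> 0" and [measurable]: "h \<in> borel_measurable borel"
  shows "(\<integral>\<^sup>+x. h x \<partial>lborel) = ennreal \<bar>det A\<bar> * (\<integral>\<^sup>+u. h (m + A *v u) \<partial>lborel)"
proof -
  have "(\<integral>\<^sup>+x. h x \<partial>lborel) = (\<integral>\<^sup>+x. h x \<partial>distr lborel borel ((+) m))"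
    by (simp only: lborel_distr_plus)
  also have "\<dots> = (\<integral>\<^sup>+x. h (m + x) \<partial>lborel)" by (subst nn_integral_distr) auto
  also have "\<dots> = ennreal \<bar>det A\<bar> * (\<integral>\<^sup>+u. h (m + A *v u) \<partial>lborel)"
    by (rule nn_integral_lborel_matrix) (use assms in auto)
  finally show ?thesis .
qed

section \<open>Gaussian laws and their moments\<close>

lemma borel_measurable_matrix_vector_mult[measurable (raw)]:
  fixes A :: "real^'n^'m"
  assumes "f \<in> borel_measurable M"
  shows "(\<lambda>x. A *v f x) \<in> borel_measurable M"
proof -
  have "(*v) A \<in> borel_measurable borel"
    by (intro borel_measurable_continuous_onI linear_continuous_on matrix_vector_mul_bounded_linear)
  from measurable_compose[OF assms this] show ?thesis .
qed

lemma borel_measurable_vec_nth[measurable (raw)]: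
  fixes f :: "'a \<Rightarrow> real^'n"
  assumes "f \<in> borel_measurable M"
  shows "(\<lambda>x. f x $ i) \<in> borel_measurable M"
proof -
  have "(\<lambda>v::real^'n. v $ i) \<in> borel_measurable borel"
    by (intro borel_measurable_continuous_onI continuous_intros)
  from measurable_compose[OF assms this] show ?thesis .
qed

lemma sets_gaussian[simp, measurable_cong]: "sets (gaussian m S) = sets borel"
  by (simp add: gaussian_def)

lemma space_gaussian[simp]: "space (gaussian m S) = UNIV"
  by (simp add: gaussian_def)

lemma std_gaussian_eq_prod:
  "gaussian 0 (mat 1 :: real^'n^'n)
    = density lborel (\<lambda>x. \<Prod>b\<in>Basis. ennreal (std_normal_density (x \<bullet> b)))"
proof -
  have "(\<Prod>b\<in>Basis. std_normal_density (x \<bullet> b))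
      = exp (- (x \<bullet> x) / 2) / sqrt ((2 * pi) ^ CARD('n))" for x :: "real^'n"
  proof -
    have "(\<Prod>b\<in>Basis. std_normal_density (x \<bullet> b))
      = (1 / sqrt (2 * pi)) ^ CARD('n) * exp (\<Sum>b\<in>Basis. - (x \<bullet> b)\<^sup>2 / 2)"
      by (simp add: std_normal_density_def prod_dividef exp_sum power_one_over)
    also have "(\<Sum>b\<in>Basis. - (x \<bullet> b)\<^sup>2 / 2) = - (x \<bullet> x) / 2"
      by (subst euclidean_inner[of x x])
        (simp add: power2_eq_square sum_negf sum_divide_distrib)
    finally show ?thesis
      by (simp add: real_sqrt_power real_sqrt_mult power_mult_distrib power_one_over)
  qed
  then show ?thesis by (simp add: gaussian_def prod_ennreal)
qed

lemma nn_integral_std_normal_density: "(\<integral>\<^sup>+x. ennreal (std_normal_density x) \<partial>lborel) = 1"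
  using prob_space_normal_density[of 1 0]
  by (simp add: prob_space_def prob_space_axioms_def emeasure_density)

lemma prob_space_std_gaussian: "prob_space (gaussian 0 (mat 1 :: real^'n^'n))"
  using nn_integral_lborel_prod[of "\<lambda>_::real^'n. std_normal_density"]
  by (intro prob_spaceI)
    (simp add: std_gaussian_eq_prod emeasure_density nn_integral_std_normal_density prod_ennreal)

lemma nn_integral_std_gaussian_sq:
  "(\<integral>\<^sup>+u. ennreal ((u $ i)\<^sup>2) \<partial>gaussian 0 (mat 1 :: real^'n^'n)) = 1"
proof -
  define f where "f b x = std_normal_density x * (if b = axis i 1 then x\<^sup>2 else 1)" for b :: "real^'n" and x
  have f0: "0 \<le> f b x" for b x by (simp add: f_def)
  have [measurable]: "f b \<in> borel_measurable borel" for b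
    unfolding f_def[abs_def] by (cases "b = axis i 1") auto
  have 1: "(\<Prod>b\<in>Basis. f b (x \<bullet> b)) = (\<Prod>b\<in>Basis. std_normal_density (x \<bullet> b)) * (x $ i)\<^sup>2" for x :: "real^'n"
    by (simp add: f_def prod.distrib prod.delta inner_axis axis_in_Basis_iff)
  have "(\<integral>\<^sup>+u. ennreal ((u $ i)\<^sup>2) \<partial>gaussian 0 (mat 1 :: real^'n^'n))
      = (\<integral>\<^sup>+u. (\<Prod>b\<in>Basis. ennreal (f b (u \<bullet> b))) \<partial>lborel)"
    unfolding std_gaussian_eq_prod
    by (simp add: nn_integral_density prod_ennreal prod_nonneg ennreal_mult'[symmetric] f0 1)
  also have "\<dots> = (\<Prod>b\<in>Basis. \<integral>\<^sup>+x. ennreal (f b x) \<partial>lborel)"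
    by (rule nn_integral_lborel_prod) (auto simp: f0)
  also have "\<dots> = (\<Prod>b\<in>(Basis::(real^'n) set). 1)"
  proof (rule prod.cong)
    fix b :: "real^'n"
    have "(\<integral>\<^sup>+x. ennreal (std_normal_density x * x\<^sup>2) \<partial>lborel) = 1"
      using std_normal_moment_even[of 1]
      by (subst nn_integral_eq_integral) (auto simp: has_bochner_integral_iff)
    then show "(\<integral>\<^sup>+x. ennreal (f b x) \<partial>lborel) = 1"
      using nn_integral_std_normal_density by (cases "b = axis i 1") (auto simp: f_def)
  qed auto
  finally show ?thesis by simp
qed

text \<open>Every non-degenerate Gaussian law is an affine image of the standard one; its normalization
  and moments are read off from this.\<close>

lemma gaussian_affine:
  fixes T S :: "real^'n^'n"
  assumes T: "transpose T = T" "T ** T = S" "det T \<noteq> 0"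
  shows "gaussian m S = distr (gaussian 0 (mat 1)) borel (\<lambda>u. m + T *v u)"
proof (rule measure_eqI)
  let ?c = "sqrt ((2 * pi) ^ CARD('n))"
  let ?Si = "matrix_inv S"
  have detS: "det S = (det T)\<^sup>2" using T(2) by (metis det_mul power2_eq_square)
  have Ti: "invertible T" using T by (simp add: invertible_det_nz)
  note TTi = invertible_matrix_inv[OF Ti]
  have TST: "T ** ?Si ** T = mat 1"
  proof -
    have "matrix_inv S = matrix_inv T ** matrix_inv T"
      by (rule matrix_inv_eqI) (metis T(2) TTi(1) matrix_mul_assoc matrix_mul_rid)
    then show ?thesis by (metis TTi matrix_mul_assoc matrix_mul_lid)
  qed
  have quad: "(T *v u) \<bullet> (?Si *v (T *v u)) = u \<bullet> u" for u
  proof -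
    have "(T *v u) \<bullet> (?Si *v (T *v u)) = u \<bullet> ((T ** ?Si ** T) *v u)"
      using inner_matrix_symmetric[OF T(1)] by (simp add: matrix_vector_mul_assoc[symmetric])
    then show ?thesis by (simp add: TST)
  qed
  fix X assume "X \<in> sets (gaussian m S)"
  then have X[measurable]: "X \<in> sets borel" by simp
  let ?d = "\<lambda>x. ennreal (exp (- ((x - m) \<bullet> (?Si *v (x - m))) / 2) / sqrt ((2 * pi) ^ CARD('n) * det S))"
  have "emeasure (gaussian m S) X = (\<integral>\<^sup>+x. ?d x * indicator X x \<partial>lborel)"
    unfolding gaussian_def by (subst emeasure_density) auto
  also have "\<dots> = ennreal \<bar>det T\<bar> * (\<integral>\<^sup>+u. ?d (m + T *v u) * indicator X (m + T *v u) \<partial>lborel)"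
    by (rule nn_integral_lborel_affine[OF T(3)]) measurable
  also have "\<dots> = (\<integral>\<^sup>+u. ennreal \<bar>det T\<bar> * (?d (m + T *v u) * indicator X (m + T *v u)) \<partial>lborel)"
    by (rule nn_integral_cmult[symmetric]) measurable
  also have "\<dots> = (\<integral>\<^sup>+u. ennreal (exp (- (u \<bullet> u) / 2) / ?c) * indicator X (m + T *v u) \<partial>lborel)"
    using T(3) by (intro nn_integral_cong)
      (simp add: quad detS real_sqrt_mult mult.assoc[symmetric] ennreal_mult'[symmetric])
  also have "\<dots> = (\<integral>\<^sup>+u. indicator X (m + T *v u) \<partial>gaussian 0 (mat 1))"
    unfolding gaussian_def by (subst nn_integral_density) auto
  also have "\<dots> = (\<integral>\<^sup>+x. indicator X x \<partial>distr (gaussian 0 (mat 1)) borel (\<lambda>u. m + T *v u))"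
    by (subst nn_integral_distr) auto
  also have "\<dots> = emeasure (distr (gaussian 0 (mat 1)) borel (\<lambda>u. m + T *v u)) X"
    by simp
  finally show "emeasure (gaussian m S) X = emeasure (distr (gaussian 0 (mat 1)) borel (\<lambda>u. m + T *v u)) X" .
qed simp

lemma gaussian_eq_distr:
  assumes "pos_def S"
  shows "gaussian m S = distr (gaussian 0 (mat 1)) borel (\<lambda>u. m + msqrt S *v u)"
  using msqrt_pos_def[OF assms] by (intro gaussian_affine) (auto simp: det_pos_def_nz pos_def_def)

lemma prob_space_gaussian:
  assumes "pos_def S" shows "prob_space (gaussian m S)"
  unfolding gaussian_eq_distr[OF assms]
  by (rule prob_space.prob_space_distr[OF prob_space_std_gaussian]) measurable

lemma std_gaussian_integrable:
  fixes i j :: "'n::finite"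
  defines "G \<equiv> gaussian 0 (mat 1 :: real^'n^'n)"
  shows "integrable G (\<lambda>u. u $ i * u $ j)" and "integrable G (\<lambda>u. u $ i)"
proof -
  interpret prob_space G unfolding G_def by (rule prob_space_std_gaussian)
  have [measurable_cong]: "sets G = sets borel" by (simp add: G_def)
  have sq: "integrable G (\<lambda>u. (u $ k)\<^sup>2)" for k
    using nn_integral_std_gaussian_sq[of k, folded G_def] by (intro integrableI_nonneg) auto
  show "integrable G (\<lambda>u. u $ i * u $ j)"
  proof (rule Bochner_Integration.integrable_bound)
    show "integrable G (\<lambda>u. (u $ i)\<^sup>2 + (u $ j)\<^sup>2)" using sq by auto
    have "\<bar>a * b\<bar> \<le> a\<^sup>2 + b\<^sup>2" for a b :: real
    proof -
      have "\<bar>a\<bar> * \<bar>b\<bar> \<le> (\<bar>a\<bar>\<^sup>2 + \<bar>b\<bar>\<^sup>2) / 2"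
        using sum_squares_bound[of "\<bar>a\<bar>" "\<bar>b\<bar>"] by simp
      also have "\<dots> \<le> a\<^sup>2 + b\<^sup>2" by simp
      finally show ?thesis by (simp add: abs_mult)
    qed
    then show "AE u in G. norm (u $ i * u $ j) \<le> norm ((u $ i)\<^sup>2 + (u $ j)\<^sup>2)" by simp
  qed measurable
  show "integrable G (\<lambda>u. u $ i)"
  proof (rule Bochner_Integration.integrable_bound)
    show "integrable G (\<lambda>u. 1 + (u $ i)\<^sup>2)" using sq by auto
    have "\<bar>a\<bar> \<le> 1 + a\<^sup>2" for a :: real
      using sum_squares_bound[of "\<bar>a\<bar>" 1] by simp
    then show "AE u in G. norm (u $ i) \<le> norm (1 + (u $ i)\<^sup>2)" by simp
  qed measurable
qed

text \<open>The standard Gaussian law is invariant under sign change of one coordinate, so functions that are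
  odd under this reflection have mean zero.\<close>

lemma std_gaussian_reflect:
  fixes h :: "real^'n \<Rightarrow> real"
  assumes "h \<in> borel_measurable borel" and "\<And>u. h (\<chi> j. if j = i then - u $ j else u $ j) = - h u"
  shows "(\<integral>u. h u \<partial>gaussian 0 (mat 1)) = 0"
proof -
  define T where "T = ((\<chi> j k. if j = k then if j = i then - 1 else 1 else 0) :: real^'n^'n)"
  have Tu: "T *v u = (\<chi> j. if j = i then - u $ j else u $ j)" for u
  proof -
    have "(\<Sum>k\<in>UNIV. T $ j $ k * u $ k) = (\<Sum>k\<in>UNIV. if k = j then (if j = i then - u $ j else u $ j) else 0)" for j
      unfolding T_def by (intro sum.cong) auto
    then show ?thesis by (simp add: matrix_vector_mult_def vec_eq_iff)
  qed
  have sym: "transpose T = T" by (auto simp: T_def transpose_def vec_eq_iff)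
  have TT: "T ** T = mat 1"
    unfolding matrix_eq by (simp add: matrix_vector_mul_assoc[symmetric] Tu vec_eq_iff)
  then have "det T * det T = 1" by (metis det_mul det_I)
  then have "det T \<noteq> 0" by auto
  from gaussian_affine[OF sym TT this, of 0]
  have "(\<integral>u. h u \<partial>gaussian 0 (mat 1)) = (\<integral>u. h u \<partial>distr (gaussian 0 (mat 1)) borel ((*v) T))" by simp
  also have "\<dots> = (\<integral>u. h (T *v u) \<partial>gaussian 0 (mat 1))"
    using assms(1) by (subst integral_distr) auto
  also have "\<dots> = - (\<integral>u. h u \<partial>gaussian 0 (mat 1))"
    by (simp add: Tu assms(2))
  finally show ?thesis by simp
qed

lemma std_gaussian_integral:
  fixes i j :: "'n::finite"
  defines "G \<equiv> gaussian 0 (mat 1 :: real^'n^'n)"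
  shows "(\<integral>u. u $ i * u $ j \<partial>G) = (if i = j then 1 else 0)" and "(\<integral>u. u $ i \<partial>G) = 0"
proof -
  have [measurable_cong]: "sets G = sets borel" by (simp add: G_def)
  show "(\<integral>u. u $ i \<partial>G) = 0" unfolding G_def
    by (rule std_gaussian_reflect[of _ i]) auto
  show "(\<integral>u. u $ i * u $ j \<partial>G) = (if i = j then 1 else 0)"
  proof (cases "i = j")
    case True
    then show ?thesis
      using nn_integral_std_gaussian_sq[of j, folded G_def]
      by (simp add: power2_eq_square integral_eq_nn_integral)
  next
    case False
    then show ?thesis unfolding G_def
      by (simp, intro std_gaussian_reflect[of _ i]) auto
  qed
qed

lemma gaussian_linear_moment:
  fixes S :: "real^'n^'n"
  assumes "pos_def S"
  shows "integrable (gaussian m S) (\<lambda>x. v \<bullet> (x - m))" "(\<integral>x. v \<bullet> (x - m) \<partial>gaussian m S) = 0"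
proof -
  have v: "v \<bullet> (msqrt S *v u) = (\<Sum>i\<in>UNIV. (v v* msqrt S) $ i * u $ i)" for u
    by (metis dot_lmul_matrix inner_real_def inner_vec_def)
  show "integrable (gaussian m S) (\<lambda>x. v \<bullet> (x - m))"
    unfolding gaussian_eq_distr[OF assms]
    by (subst integrable_distr_eq) (auto simp: v std_gaussian_integrable)
  show "(\<integral>x. v \<bullet> (x - m) \<partial>gaussian m S) = 0"
    unfolding gaussian_eq_distr[OF assms]
    by (subst integral_distr) (auto simp: v std_gaussian_integrable std_gaussian_integral)
qed

lemma gaussian_quadratic_moment:
  fixes S M :: "real^'n^'n"
  assumes "pos_def S"
  shows "integrable (gaussian m S) (\<lambda>x. (x - m) \<bullet> (M *v (x - m)))"
    "(\<integral>x. (x - m) \<bullet> (M *v (x - m)) \<partial>gaussian m S) = trace (M ** S)"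
proof -
  define T where "T = msqrt S"
  have T: "transpose T = T" "T ** T = S" using msqrt_pos_def[OF assms] by (auto simp: T_def pos_def_def)
  let ?N = "T ** M ** T"
  have q: "(T *v u) \<bullet> (M *v (T *v u)) = (\<Sum>i\<in>UNIV. \<Sum>j\<in>UNIV. ?N $ i $ j * (u $ i * u $ j))" for u
  proof -
    have "(T *v u) \<bullet> (M *v (T *v u)) = u \<bullet> (?N *v u)"
      using inner_matrix_symmetric[OF T(1)] by (simp add: matrix_vector_mul_assoc[symmetric])
    then show ?thesis
      by (simp add: inner_vec_def matrix_vector_mult_def sum_distrib_left mult_ac)
  qed
  show "integrable (gaussian m S) (\<lambda>x. (x - m) \<bullet> (M *v (x - m)))"
    unfolding gaussian_eq_distr[OF assms] T_def[symmetric]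
    by (subst integrable_distr_eq) (auto simp: q std_gaussian_integrable)
  have "(\<integral>x. (x - m) \<bullet> (M *v (x - m)) \<partial>gaussian m S)
      = (\<Sum>i\<in>UNIV. \<Sum>j\<in>UNIV. ?N $ i $ j * (if i = j then 1 else 0))"
    unfolding gaussian_eq_distr[OF assms] T_def[symmetric]
    by (subst integral_distr) (auto simp: q std_gaussian_integrable std_gaussian_integral)
  also have "\<dots> = trace ?N" by (simp add: trace_def if_distrib cong: if_cong)
  also have "\<dots> = trace (M ** S)"
    by (metis T(2) matrix_mul_assoc trace_mul_sym)
  finally show "(\<integral>x. (x - m) \<bullet> (M *v (x - m)) \<partial>gaussian m S) = trace (M ** S)" .
qed

lemma norm_diff_sq_le: "(norm (x - y))\<^sup>2 \<le> 2 * (norm x)\<^sup>2 + 2 * (norm (y::'a::real_inner))\<^sup>2"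
proof -
  have "0 \<le> (norm (x + y))\<^sup>2" by simp
  then show ?thesis
    by (simp add: power2_norm_eq_inner inner_simps inner_commute)
qed

lemma gaussian_second_moment:
  fixes M :: "real^'n^'n"
  assumes "pos_def M"
  shows "integrable (gaussian m M) (\<lambda>x. (norm x)\<^sup>2)"
proof (rule Bochner_Integration.integrable_bound)
  interpret prob_space "gaussian m M" by (rule prob_space_gaussian) fact
  show "integrable (gaussian m M) (\<lambda>x. 2 * ((x - m) \<bullet> (mat 1 *v (x - m))) + 2 * (norm (- m))\<^sup>2)"
    using gaussian_quadratic_moment(1)[OF assms, of m "mat 1"]
    by (intro Bochner_Integration.integrable_add integrable_mult_right) auto
  have "(norm x)\<^sup>2 \<le> 2 * ((x - m) \<bullet> (x - m)) + 2 * (norm (- m))\<^sup>2" for x :: "real^'n"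
    using norm_diff_sq_le[of "x - m" "- m"] by (simp add: dot_square_norm)
  then show "AE x in gaussian m M. norm ((norm x)\<^sup>2)
      \<le> norm (2 * ((x - m) \<bullet> (mat 1 *v (x - m))) + 2 * (norm (- m))\<^sup>2)"
    by (auto simp: abs_of_nonneg intro!: AE_I2)
qed measurable

section \<open>Block vectors and block matrices\<close>

lemma inner_sum_vec:
  fixes z w :: "real^('m::finite + 'n::finite)"
  shows "z \<bullet> w = fst (split_vec z) \<bullet> fst (split_vec w) + snd (split_vec z) \<bullet> snd (split_vec w)"
proof -
  have "(\<Sum>k\<in>UNIV. z $ k * w $ k) = (\<Sum>k\<in>UNIV <+> UNIV. z $ k * w $ k)" by simp
  also have "\<dots> = (\<Sum>i\<in>UNIV. z $ Inl i * w $ Inl i) + (\<Sum>j\<in>UNIV. z $ Inr j * w $ Inr j)"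
    by (subst sum.Plus) auto
  finally show ?thesis by (simp add: inner_vec_def split_vec_def)
qed

lemma split_vec_join_vec [simp]: "split_vec (join_vec x y) = (x, y)"
  by (simp add: split_vec_def join_vec_def)

lemma join_vec_split_vec [simp]: "join_vec (fst (split_vec z)) (snd (split_vec z)) = z"
  by (auto simp: split_vec_def join_vec_def vec_eq_iff split: sum.split)

lemma split_vec_eq_iff: "split_vec z = split_vec w \<longleftrightarrow> z = w"
  by (metis join_vec_split_vec)

lemma split_vec_diff: "split_vec (z - w) = split_vec z - split_vec w"
  by (simp add: split_vec_def vec_eq_iff)

lemma split_vec_block_mat_mult:
  "split_vec (block_mat P Q R S *v z)
    = (P *v fst (split_vec z) + Q *v snd (split_vec z), R *v fst (split_vec z) + S *v snd (split_vec z))"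
proof -
  have *: "(\<Sum>k\<in>UNIV. g k) = (\<Sum>i\<in>UNIV. g (Inl i)) + (\<Sum>j\<in>UNIV. g (Inr j))"
    for g :: "'a + 'b \<Rightarrow> real"
    using sum.Plus[of "UNIV::'a set" "UNIV::'b set" g] by simp
  show ?thesis
    by (simp add: split_vec_def block_mat_def matrix_vector_mult_def vec_eq_iff *)
qed

lemma borel_measurable_split_vec[measurable]:
  "(split_vec :: real^('m::finite + 'n::finite) \<Rightarrow> _) \<in> borel_measurable borel"
  unfolding split_vec_def
  by (intro borel_measurable_continuous_onI continuous_intros)

lemma borel_measurable_join_vec[measurable]:
  "(\<lambda>z. join_vec (fst z) (snd z) :: real^('m::finite + 'n::finite)) \<in> borel_measurable borel"
proof (rule borel_measurable_continuous_onI)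
  have "continuous_on UNIV (\<lambda>z. case k of Inl i \<Rightarrow> fst z $ i | Inr j \<Rightarrow> snd z $ j)" for k :: "'m + 'n"
    by (cases k) (auto intro!: continuous_intros)
  then show "continuous_on UNIV (\<lambda>z. join_vec (fst z) (snd z) :: real^('m + 'n))"
    unfolding join_vec_def by (intro continuous_on_vec_lambda)
qed

lemma distr_lborel_split_vec:
  "distr lborel borel (split_vec :: real^('m::finite + 'n::finite) \<Rightarrow> _) = lborel"
proof (rule lborel_eqI[symmetric])
  fix l u :: "(real^'m) \<times> (real^'n)"
  assume lu: "\<And>b. b \<in> Basis \<Longrightarrow> l \<bullet> b \<le> u \<bullet> b"
  obtain l1 l2 u1 u2 where l: "l = (l1, l2)" and u: "u = (u1, u2)" by fastforce
  have le1: "l1 \<bullet> b \<le> u1 \<bullet> b" if "b \<in> Basis" for b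
    using lu[of "(b, 0)"] that by (simp add: l u Basis_prod_def)
  have le2: "l2 \<bullet> b \<le> u2 \<bullet> b" if "b \<in> Basis" for b
    using lu[of "(0, b)"] that by (simp add: l u Basis_prod_def)
  have le1': "l1 $ i \<le> u1 $ i" for i using le1[of "axis i 1"] by (simp add: inner_axis axis_in_Basis_iff)
  have le2': "l2 $ i \<le> u2 $ i" for i using le2[of "axis i 1"] by (simp add: inner_axis axis_in_Basis_iff)
  let ?L = "join_vec l1 l2" and ?U = "join_vec u1 u2"
  have "split_vec -` box l u = box ?L ?U"
  proof -
    have all: "(\<forall>k::'m + 'n. P k) \<longleftrightarrow> (\<forall>i. P (Inl i)) \<and> (\<forall>j. P (Inr j))" for P
      by (metis sum.exhaust)
    have "x \<in> split_vec -` box l u \<longleftrightarrow> x \<in> box ?L ?U" for x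
      unfolding mem_box_cart all by (simp add: l u box_prod mem_box_cart join_vec_def split_vec_def)
    then show ?thesis by blast
  qed
  then have "emeasure (distr lborel borel split_vec) (box l u) = emeasure lborel (box ?L ?U)"
    by (simp add: emeasure_distr)
  also have "\<dots> = ennreal (\<Prod>k\<in>UNIV. (?U - ?L) $ k)"
  proof (subst emeasure_lborel_box)
    fix b :: "real^('m + 'n)" assume "b \<in> Basis"
    then obtain k where "b = axis k 1" by (auto simp: Basis_vec_def)
    then show "?L \<bullet> b \<le> ?U \<bullet> b"
      using le1' le2' by (cases k) (auto simp: inner_axis join_vec_def)
  qed (simp add: prod_Basis_vec inner_axis)
  also have "(\<Prod>k\<in>UNIV. (?U - ?L) $ k)
      = (\<Prod>i\<in>UNIV. (u1 - l1) $ i) * (\<Prod>j\<in>UNIV. (u2 - l2) $ j)"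
    using prod.Plus[of UNIV UNIV "\<lambda>k. (?U - ?L) $ k"] by (simp add: join_vec_def)
  also have "ennreal \<dots> = emeasure lborel (box l1 u1) * emeasure lborel (box l2 u2)"
    using le1 le2 le1' le2'
    by (simp add: prod_Basis_vec inner_axis ennreal_mult' prod_nonneg)
  also have "\<dots> = emeasure (lborel \<Otimes>\<^sub>M lborel) (box l1 u1 \<times> box l2 u2)"
    by (simp add: lborel.emeasure_pair_measure_Times)
  also have "\<dots> = emeasure lborel (box l u)"
    by (simp add: lborel_prod box_prod l u)
  also have "\<dots> = (\<Prod>b\<in>Basis. (u - l) \<bullet> b)"
    using lu by simp
  finally show "emeasure (distr lborel borel split_vec) (box l u) = (\<Prod>b\<in>Basis. (u - l) \<bullet> b)" .
qed simp

lemma block_mat_matrix_inv: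
  fixes A P :: "real^'m^'m" and B Q :: "real^'n^'n"
  assumes "A ** P + C ** V = mat 1" "A ** U + C ** Q = 0" "W ** P + B ** V = 0" "W ** U + B ** Q = mat 1"
  shows "matrix_inv (block_mat A C W B) = block_mat P U V Q"
proof (rule matrix_inv_eqI)
  let ?A = "block_mat A C W B" and ?B = "block_mat P U V Q"
  have "?A *v (?B *v z) = z" for z
  proof -
    have 1: "A *v (P *v x) + C *v (V *v x) = x" "A *v (U *v y) + C *v (Q *v y) = 0"
      "W *v (P *v x) + B *v (V *v x) = 0" "W *v (U *v y) + B *v (Q *v y) = y" for x y
      by (simp_all add: assms matrix_vector_mul_assoc matrix_vector_mult_add_rdistrib[symmetric])
    obtain x y where z: "split_vec z = (x, y)" by fastforce
    have "split_vec (?A *v (?B *v z))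
      = ((A *v (P *v x) + C *v (V *v x)) + (A *v (U *v y) + C *v (Q *v y)),
         (W *v (P *v x) + B *v (V *v x)) + (W *v (U *v y) + B *v (Q *v y)))"
      by (simp add: split_vec_block_mat_mult z matrix_vector_right_distrib)
    then have "split_vec (?A *v (?B *v z)) = split_vec z"
      by (simp only: 1 z add_0_left add_0_right)
    then show ?thesis by (simp add: split_vec_eq_iff)
  qed
  then show "?A ** ?B = mat 1" by (simp add: matrix_eq matrix_vector_mul_assoc)
qed

lemma transpose_block_mat:
  "transpose (block_mat P Q R S) = block_mat (transpose P) (transpose R) (transpose Q) (transpose S)"
  by (auto simp: transpose_def block_mat_def vec_eq_iff split: sum.split)

text \<open>The normalizing constant of a probability density is determined by its shape. This makes
  block determinants unnecessary when Gaussian densities are compared.\<close>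

lemma prob_density_eq_normalized:
  fixes q :: "'a \<Rightarrow> ennreal" and c d :: real
  assumes [measurable]: "q \<in> borel_measurable M"
    and c: "0 \<le> c" "prob_space (density M (\<lambda>x. ennreal c * q x))"
    and d: "0 \<le> d" "prob_space (density M (\<lambda>x. ennreal d * q x))"
  shows "c = d"
proof -
  let ?I = "\<integral>\<^sup>+x. q x \<partial>M"
  have "emeasure (density M (\<lambda>x. ennreal c * q x)) (space M) = 1"
    using prob_space.emeasure_space_1[OF c(2)] by simp
  then have cI: "ennreal c * ?I = 1" by (simp add: emeasure_density nn_integral_cmult)
  have "emeasure (density M (\<lambda>x. ennreal d * q x)) (space M) = 1"
    using prob_space.emeasure_space_1[OF d(2)] by simp
  then have dI: "ennreal d * ?I = 1" by (simp add: emeasure_density nn_integral_cmult)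
  have "?I \<noteq> 0" using cI by auto
  moreover have "?I \<noteq> \<infinity>" 
  proof
    assume "?I = \<infinity>"
    with cI show False by (simp add: ennreal_mult_top split: if_splits)
  qed
  ultimately have "ennreal c = ennreal d"
    using cI dI ennreal_mult_cancel_left[of ?I "ennreal c" "ennreal d"] by (simp add: mult.commute)
  then show ?thesis using c(1) d(1) by simp
qed

lemma gaussian_prod_density:
  fixes S :: "real^('m::finite + 'n::finite)^('m + 'n)"
  shows "gaussian_prod (join_vec a b) S = density lborel (\<lambda>z. ennreal
     (exp (- ((join_vec (fst z) (snd z) - join_vec a b) \<bullet> (matrix_inv S *v (join_vec (fst z) (snd z) - join_vec a b))) / 2)
        / sqrt ((2 * pi) ^ CARD('m + 'n) * det S)))"
proof -
  let ?d = "\<lambda>z. ennreal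
     (exp (- ((join_vec (fst z) (snd z) - join_vec a b) \<bullet> (matrix_inv S *v (join_vec (fst z) (snd z) - join_vec a b))) / 2)
        / sqrt ((2 * pi) ^ CARD('m + 'n) * det S))"
  have "density (distr lborel borel (split_vec :: real^('m + 'n) \<Rightarrow> _)) ?d
      = distr (density lborel (\<lambda>z. ?d (split_vec z))) borel split_vec"
    by (rule density_distr) measurable
  then show ?thesis
    by (simp add: distr_lborel_split_vec gaussian_prod_def gaussian_def)
qed

section \<open>Tilted Gaussian integrals\<close>

text \<open>Completion of the square: up to a constant, the tilted Gaussian density is the density of the
  Gaussian law with mean \<open>a + matrix_inv P *v w\<close> and covariance \<open>matrix_inv P\<close>.\<close>

lemma gaussian_tilt_integral:
  fixes A P :: "real^'n^'n"
  assumes A: "pos_def A" and P: "pos_def P"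
  shows "(\<integral>\<^sup>+x. ennreal (exp (k - (x - a) \<bullet> (P *v (x - a)) / 2 + (x - a) \<bullet> w
        + (x - a) \<bullet> (matrix_inv A *v (x - a)) / 2)) \<partial>gaussian a A)
     = ennreal (exp (k + w \<bullet> (matrix_inv P *v w) / 2) / sqrt (det A * det P))"
proof -
  let ?n = "(2 * pi) ^ CARD('n)"
  define v where "v = matrix_inv P *v w"
  note Pi = invertible_matrix_inv[OF pos_def_invertible[OF P]]
  have Pv: "P *v v = w" by (simp add: v_def matrix_vector_mul_assoc Pi)
  have detA: "0 < det A" and detP: "0 < det P" using A P det_pos_def_pos by auto
  have detPi: "det (matrix_inv P) = 1 / det P"
    using Pi(1) detP by (metis det_mul det_I nonzero_mult_div_cancel_left less_irrefl)
  have sq: "(x - a) \<bullet> (P *v (x - a)) - 2 * ((x - a) \<bullet> w)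
      = (x - (a + v)) \<bullet> (P *v (x - (a + v))) - w \<bullet> v" for x
  proof -
    define z where "z = x - a"
    have "(z - v) \<bullet> (P *v (z - v)) = z \<bullet> (P *v z) - 2 * (z \<bullet> w) + w \<bullet> v"
      using inner_matrix_symmetric[of P v z] P Pv
      by (simp add: pos_def_def matrix_vector_mult_diff_distrib inner_simps inner_commute)
    then show ?thesis by (simp add: z_def algebra_simps)
  qed
  let ?e = "\<lambda>x. exp (k - (x - a) \<bullet> (P *v (x - a)) / 2 + (x - a) \<bullet> w
        + (x - a) \<bullet> (matrix_inv A *v (x - a)) / 2)"
  let ?C = "exp (k + w \<bullet> v / 2) / sqrt (det A * det P)"
  let ?d = "\<lambda>x. exp (- ((x - (a + v)) \<bullet> (matrix_inv (matrix_inv P) *v (x - (a + v)))) / 2) / sqrt (?n * det (matrix_inv P))"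
  have "(\<integral>\<^sup>+x. ennreal (?e x) \<partial>gaussian a A)
    = (\<integral>\<^sup>+x. ennreal (exp (- ((x - a) \<bullet> (matrix_inv A *v (x - a))) / 2) / sqrt (?n * det A)) * ennreal (?e x) \<partial>lborel)"
    unfolding gaussian_def by (subst nn_integral_density) auto
  also have "\<dots> = (\<integral>\<^sup>+x. ennreal ?C * ennreal (?d x) \<partial>lborel)"
  proof (intro nn_integral_cong)
    fix x :: "real^'n"
    have "exp (- ((x - a) \<bullet> (matrix_inv A *v (x - a))) / 2) * ?e x
        = exp (k - ((x - a) \<bullet> (P *v (x - a)) - 2 * ((x - a) \<bullet> w)) / 2)"
      by (simp add: exp_add[symmetric] field_simps)
    also have "\<dots> = exp (k + w \<bullet> v / 2) * exp (- ((x - (a + v)) \<bullet> (P *v (x - (a + v)))) / 2)"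
      unfolding sq by (simp add: exp_add[symmetric] field_simps)
    finally have "exp (- ((x - a) \<bullet> (matrix_inv A *v (x - a))) / 2) / sqrt (?n * det A) * ?e x = ?C * ?d x"
      using detA detP pos_def_matrix_inv(2)[OF P]
      by (simp add: real_sqrt_mult real_sqrt_divide detPi field_simps)
    then show "ennreal (exp (- ((x - a) \<bullet> (matrix_inv A *v (x - a))) / 2) / sqrt (?n * det A)) * ennreal (?e x)
        = ennreal ?C * ennreal (?d x)"
      using detA detP by (simp add: ennreal_mult'[symmetric] detPi del: exp_le_cancel_iff)
  qed
  also have "\<dots> = ennreal ?C * (\<integral>\<^sup>+x. ennreal (?d x) \<partial>lborel)"
    by (rule nn_integral_cmult) measurable
  also have "(\<integral>\<^sup>+x. ennreal (?d x) \<partial>lborel) = 1"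
    using prob_space.emeasure_space_1[OF prob_space_gaussian[OF pos_def_matrix_inv(1)[OF P], of "a + v"]]
    by (simp add: gaussian_def emeasure_density)
  finally show ?thesis by (simp add: v_def)
qed

section \<open>Optimality from entropic potentials\<close>

text \<open>Strict Gibbs inequality relative to a reference measure \<open>M\<close>: since
  \<open>KL (N | M) - (\<integral> ln R dN)\<close> is the divergence of \<open>N\<close> from \<open>density M R\<close>, it is nonnegative
  and vanishes only for \<open>N = density M R\<close>.\<close>

lemma gibbs_inequality:
  fixes R :: "'a \<Rightarrow> real"
  assumes "prob_space M" and R[measurable]: "R \<in> borel_measurable M" and pos: "\<And>z. 0 < R z"
    and "prob_space (density M R)"
    and "prob_space N" and sets: "sets N = sets M" and ac: "absolutely_continuous M N"
    and int: "integrable N (entropy_density (exp 1) M N)" and intR: "integrable N (\<lambda>z. ln (R z))"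
  shows "(\<integral>z. ln (R z) \<partial>N) \<le> KL_divergence (exp 1) M N"
    and "KL_divergence (exp 1) M N = (\<integral>z. ln (R z) \<partial>N) \<Longrightarrow> N = density M R"
proof -
  interpret M: prob_space M by fact
  interpret N: prob_space N by fact
  let ?V = "density M R"
  interpret V: prob_space ?V by fact
  interpret V: information_space ?V "exp 1" by standard simp
  have "finite_measure N" by unfold_locales
  from M.real_RN_deriv[OF this ac sets] obtain D where D[measurable]: "D \<in> borel_measurable M"
    and DM: "AE x in M. RN_deriv M N x = ennreal (D x)" and DN: "AE x in N. 0 < D x"
    and D0: "\<And>x. 0 \<le> D x" by this auto
  have [measurable_cong]: "sets N = sets M" by (rule sets)
  have "N = density M (RN_deriv M N)" using ac sets by (rule M.density_RN_deriv[symmetric])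
  also have "\<dots> = density M D" using DM by (auto intro!: density_cong)
  finally have N: "N = density M D" .
  have NV: "N = density ?V (\<lambda>z. D z / R z)"
  proof -
    have "density ?V (\<lambda>z. D z / R z) = density M (\<lambda>z. ennreal (R z) * ennreal (D z / R z))"
      by (subst density_density_eq) auto
    also have "\<dots> = density M D"
      using pos D0 by (intro density_cong) (auto simp: ennreal_mult'[symmetric] less_imp_le less_imp_neq[THEN not_sym])
    finally show ?thesis using N by simp
  qed
  have DN': "AE x in N. RN_deriv M N x = ennreal (D x)"
    using absolutely_continuous_AE[OF sets ac DM] .
  have eM: "AE x in N. entropy_density (exp 1) M N x = ln (D x)"
    using DN' by eventually_elim (simp add: entropy_density_def D0 log_def)
  have acV: "absolutely_continuous ?V N"
    by (subst NV) (rule absolutely_continuousI_density, measurable)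
  have setsV: "sets N = sets ?V" by (simp add: sets)
  have "AE x in ?V. D x / R x = RN_deriv ?V N x"
    by (rule V.RN_deriv_unique) (use NV in auto)
  from absolutely_continuous_AE[OF setsV acV this]
  have eV: "AE x in N. entropy_density (exp 1) ?V N x = ln (D x) - ln (R x)"
    using DN
  proof eventually_elim
    case (elim x)
    then show ?case using pos[of x]
      by (simp add: entropy_density_def log_def ln_div elim(1)[symmetric])
  qed
  have eMm: "entropy_density (exp 1) M N \<in> borel_measurable N" by measurable
  have "entropy_density (exp 1) ?V N \<in> borel_measurable ?V" by measurable
  then have eVm: "entropy_density (exp 1) ?V N \<in> borel_measurable N"
    using measurable_cong_sets[OF setsV refl] by blast
  have intD: "integrable N (\<lambda>x. ln (D x))"
    using int eM eMm by (subst integrable_cong_AE[symmetric, where f="entropy_density (exp 1) M N"]) auto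
  have KLM: "KL_divergence (exp 1) M N = (\<integral>x. ln (D x) \<partial>N)"
    unfolding KL_divergence_def using eM eMm by (intro integral_cong_AE) auto
  have KLV: "KL_divergence (exp 1) ?V N = (\<integral>x. ln (D x) \<partial>N) - (\<integral>x. ln (R x) \<partial>N)"
    unfolding KL_divergence_def Bochner_Integration.integral_diff[OF intD intR, symmetric]
    using eV eVm by (intro integral_cong_AE) auto
  have intV: "integrable N (entropy_density (exp 1) ?V N)"
    using eV eVm intD intR
    by (subst integrable_cong_AE[where g="\<lambda>x. ln (D x) - ln (R x)"]) auto
  have "0 \<le> KL_divergence (exp 1) ?V (density ?V (\<lambda>z. D z / R z))"
  proof (rule V.KL_nonneg)
    show "prob_space (density ?V (\<lambda>z. ennreal (D z / R z)))" using NV \<open>prob_space N\<close> by simp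
    show "AE x in ?V. 0 \<le> D x / R x" using D0 pos by (auto simp: less_imp_le)
    have "integrable N (\<lambda>x. log (exp 1) (D x / R x))"
      using DN intD intR pos
      by (subst integrable_cong_AE[where g="\<lambda>x. ln (D x) - ln (R x)"])
        (auto simp: log_def ln_div less_imp_neq[THEN not_sym])
    then show "integrable ?V (\<lambda>x. D x / R x * log (exp 1) (D x / R x))"
      using D0 pos unfolding NV by (subst (asm) integrable_real_density) (auto simp: less_imp_le)
  qed measurable
  then have "0 \<le> KL_divergence (exp 1) ?V N" using NV by simp
  then show "(\<integral>z. ln (R z) \<partial>N) \<le> KL_divergence (exp 1) M N" using KLM KLV by simp
  assume "KL_divergence (exp 1) M N = (\<integral>z. ln (R z) \<partial>N)"
  then have "KL_divergence (exp 1) ?V N = 0" using KLM KLV by simp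
  then show "N = ?V"
    using V.KL_eq_0_iff_eq_ac[OF \<open>prob_space N\<close> acV setsV intV] by simp
qed

lemma KL_of_density:
  fixes R :: "'a \<Rightarrow> real"
  assumes "prob_space M" and R[measurable]: "R \<in> borel_measurable M" and pos: "\<And>z. 0 < R z"
    and intR: "integrable (density M R) (\<lambda>z. ln (R z))"
  shows "KL (density M R) M = ereal (\<integral>z. ln (R z) \<partial>density M R)"
proof -
  interpret M: prob_space M by fact
  let ?V = "density M R"
  have ac: "absolutely_continuous M ?V" by (rule absolutely_continuousI_density) measurable
  have "AE x in M. ennreal (R x) = RN_deriv M ?V x"
    by (rule M.RN_deriv_unique) auto
  then have "AE x in ?V. ennreal (R x) = RN_deriv M ?V x"
    by (intro absolutely_continuous_AE[OF _ ac]) auto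
  then have e: "AE x in ?V. entropy_density (exp 1) M ?V x = ln (R x)"
  proof eventually_elim
    case (elim x)
    then show ?case using pos[of x] by (simp add: entropy_density_def log_def elim[symmetric])
  qed
  have m: "entropy_density (exp 1) M ?V \<in> borel_measurable ?V"
    by measurable
  have "integrable ?V (entropy_density (exp 1) M ?V)"
    using e m intR by (subst integrable_cong_AE[where g="\<lambda>x. ln (R x)"]) auto
  moreover have "KL_divergence (exp 1) M ?V = (\<integral>z. ln (R z) \<partial>?V)"
    unfolding KL_divergence_def using e m by (intro integral_cong_AE) auto
  ultimately show ?thesis using ac by (simp add: KL_def)
qed

text \<open>Sufficient optimality condition for entropic transport: if a coupling has a density \<open>R\<close> with
  \<open>2 \<sigma>\<^sup>2 ln R(x, y) = f(x) + g(y) - |x - y|\<^sup>2\<close>, then the objective of every coupling \<open>\<pi>\<close> of finite entropy is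
  \<open>(\<integral> f d\<alpha>) + (\<integral> g d\<beta>) + 2 \<sigma>\<^sup>2 KL (\<pi> | R (\<alpha> \<otimes> \<beta>))\<close>, because \<open>f\<close> and \<open>g\<close> integrate to the same value
  against all couplings.\<close>

lemma entropic_potentials_optimal:
  fixes \<alpha> \<beta> :: "'a::euclidean_space measure" and R :: "'a \<times> 'a \<Rightarrow> real"
  assumes \<alpha>: "prob_space \<alpha>" "sets \<alpha> = sets borel" "integrable \<alpha> (\<lambda>x. (norm x)\<^sup>2)"
    and \<beta>: "prob_space \<beta>" "sets \<beta> = sets borel" "integrable \<beta> (\<lambda>x. (norm x)\<^sup>2)"
    and \<sigma>: "0 < \<sigma>"
    and R[measurable]: "R \<in> borel_measurable borel" and pos: "\<And>z. 0 < R z"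
    and coupling: "density (\<alpha> \<Otimes>\<^sub>M \<beta>) R \<in> couplings \<alpha> \<beta>"
    and f: "integrable \<alpha> f" and g: "integrable \<beta> g"
    and pot: "\<And>x y. (norm (x - y))\<^sup>2 + 2 * \<sigma>\<^sup>2 * ln (R (x, y)) = f x + g y"
  shows "OT \<sigma> \<alpha> \<beta> = ereal ((\<integral>x. f x \<partial>\<alpha>) + (\<integral>y. g y \<partial>\<beta>))"
    and "optimal_plans \<sigma> \<alpha> \<beta> = {density (\<alpha> \<Otimes>\<^sub>M \<beta>) R}"
proof -
  interpret A: prob_space \<alpha> by fact
  interpret B: prob_space \<beta> by fact
  interpret AB: pair_prob_space \<alpha> \<beta> by unfold_locales
  let ?M = "\<alpha> \<Otimes>\<^sub>M \<beta>" and ?V = "density (\<alpha> \<Otimes>\<^sub>M \<beta>) R"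
  define K where "K = (\<integral>x. f x \<partial>\<alpha>) + (\<integral>y. g y \<partial>\<beta>)"
  have setsM: "sets ?M = sets borel"
    using sets_pair_measure_cong[OF \<alpha>(2) \<beta>(2)] unfolding borel_prod .
  have RM[measurable]: "R \<in> borel_measurable ?M"
    using R measurable_cong_sets[OF setsM refl] by blast
  have V: "prob_space ?V" using coupling by (simp add: couplings_def)
  have *: "integrable \<pi> (\<lambda>z. (norm (fst z - snd z))\<^sup>2)" (is ?i1) "integrable \<pi> (\<lambda>z. ln (R z))" (is ?i2)
    "(\<integral>z. (norm (fst z - snd z))\<^sup>2 \<partial>\<pi>) + 2 * \<sigma>\<^sup>2 * (\<integral>z. ln (R z) \<partial>\<pi>) = K" (is ?e)
    "OT_objective \<sigma> \<alpha> \<beta> \<pi> = ereal (\<integral>z. (norm (fst z - snd z))\<^sup>2 \<partial>\<pi>) + ereal (2 * \<sigma>\<^sup>2) * KL \<pi> ?M" (is ?o)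
    if "\<pi> \<in> couplings \<alpha> \<beta>" for \<pi>
  proof -
    have \<pi>: "prob_space \<pi>" and s[measurable_cong]: "sets \<pi> = sets borel"
      and m1: "distr \<pi> borel fst = \<alpha>" and m2: "distr \<pi> borel snd = \<beta>"
      using that by (auto simp: couplings_def)
    have [measurable]: "fst \<in> \<pi> \<rightarrow>\<^sub>M borel" "snd \<in> \<pi> \<rightarrow>\<^sub>M borel"
      unfolding measurable_cong_sets[OF s refl] by (simp_all add: borel_prod[symmetric])
    have 1: "integrable \<pi> (\<lambda>z. h (fst z)) \<and> (\<integral>z. h (fst z) \<partial>\<pi>) = (\<integral>x. h x \<partial>\<alpha>)"
      if h: "integrable \<alpha> h" for h :: "'a \<Rightarrow> real"
    proof -
      have [measurable]: "h \<in> borel_measurable borel"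
        using borel_measurable_integrable[OF h] measurable_cong_sets[OF \<alpha>(2) refl] by blast
      show ?thesis using h unfolding m1[symmetric] by (simp add: integrable_distr_eq integral_distr)
    qed
    have 2: "integrable \<pi> (\<lambda>z. h (snd z)) \<and> (\<integral>z. h (snd z) \<partial>\<pi>) = (\<integral>x. h x \<partial>\<beta>)"
      if h: "integrable \<beta> h" for h :: "'a \<Rightarrow> real"
    proof -
      have [measurable]: "h \<in> borel_measurable borel"
        using borel_measurable_integrable[OF h] measurable_cong_sets[OF \<beta>(2) refl] by blast
      show ?thesis using h unfolding m2[symmetric] by (simp add: integrable_distr_eq integral_distr)
    qed
    show i1: ?i1
    proof (rule Bochner_Integration.integrable_bound)
      show "integrable \<pi> (\<lambda>z. 2 * (norm (fst z))\<^sup>2 + 2 * (norm (snd z))\<^sup>2)"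
        using 1[OF \<alpha>(3)] 2[OF \<beta>(3)] by auto
    qed (auto simp: norm_diff_sq_le)
    have lnR: "ln (R z) = (f (fst z) + g (snd z) - (norm (fst z - snd z))\<^sup>2) / (2 * \<sigma>\<^sup>2)" for z
      using pot[of "fst z" "snd z"] \<sigma> by (simp add: field_simps)
    show ?i2 unfolding lnR using 1[OF f] 2[OF g] i1 by auto
    show ?e unfolding lnR K_def using 1[OF f] 2[OF g] i1 \<sigma> by simp
    show ?o unfolding OT_objective_def
      using i1 by (simp add: nn_integral_eq_integral enn2ereal_ennreal)
  qed
  have VK: "OT_objective \<sigma> \<alpha> \<beta> ?V = ereal K"
    using *[OF coupling] KL_of_density[OF AB.prob_space_axioms RM pos] by simp
  have ge: "ereal K \<le> OT_objective \<sigma> \<alpha> \<beta> \<pi> \<and> (OT_objective \<sigma> \<alpha> \<beta> \<pi> = ereal K \<longrightarrow> \<pi> = ?V)"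
    if \<pi>: "\<pi> \<in> couplings \<alpha> \<beta>" for \<pi>
  proof (cases "absolutely_continuous ?M \<pi> \<and> integrable \<pi> (entropy_density (exp 1) ?M \<pi>)")
    case False
    then have "KL \<pi> ?M = \<infinity>" by (simp add: KL_def)
    then have "OT_objective \<sigma> \<alpha> \<beta> \<pi> = \<infinity>" using *(4)[OF \<pi>] \<sigma> by simp
    then show ?thesis by simp
  next
    case True
    have p: "prob_space \<pi>" "sets \<pi> = sets ?M" using \<pi> setsM by (auto simp: couplings_def)
    note gb = gibbs_inequality[OF AB.prob_space_axioms RM pos V p conjunct1[OF True] conjunct2[OF True] *(2)[OF \<pi>]]
    define L where "L = KL_divergence (exp 1) ?M \<pi> - (\<integral>z. ln (R z) \<partial>\<pi>)"
    have L: "0 \<le> L" "L = 0 \<Longrightarrow> \<pi> = ?V" using gb by (auto simp: L_def)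
    have "OT_objective \<sigma> \<alpha> \<beta> \<pi> = ereal (K + 2 * \<sigma>\<^sup>2 * L)"
      using *(4)[OF \<pi>] True *(3)[OF \<pi>] by (simp add: KL_def L_def algebra_simps)
    then show ?thesis using L \<sigma> by auto
  qed
  show "OT \<sigma> \<alpha> \<beta> = ereal ((\<integral>x. f x \<partial>\<alpha>) + (\<integral>y. g y \<partial>\<beta>))"
    unfolding OT_def K_def[symmetric]
  proof (rule antisym)
    show "(INF \<pi>\<in>couplings \<alpha> \<beta>. OT_objective \<sigma> \<alpha> \<beta> \<pi>) \<le> ereal K"
      using INF_lower[OF coupling, of "OT_objective \<sigma> \<alpha> \<beta>"] VK by simp
  qed (use ge in \<open>auto intro: INF_greatest\<close>)
  show "optimal_plans \<sigma> \<alpha> \<beta> = {?V}"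
  proof (intro equalityI subsetI)
    fix \<pi> assume "\<pi> \<in> optimal_plans \<sigma> \<alpha> \<beta>"
    then have "\<pi> \<in> couplings \<alpha> \<beta>" "OT_objective \<sigma> \<alpha> \<beta> \<pi> \<le> ereal K"
      using coupling VK by (auto simp: optimal_plans_def)
    then show "\<pi> \<in> {?V}" using ge[of \<pi>] by (simp add: antisym)
  next
    fix \<pi> assume "\<pi> \<in> {?V}"
    then have "\<pi> = ?V" by simp
    have "OT_objective \<sigma> \<alpha> \<beta> ?V \<le> OT_objective \<sigma> \<alpha> \<beta> \<rho>" if "\<rho> \<in> couplings \<alpha> \<beta>" for \<rho>
      unfolding VK using ge[OF that] by (rule conjunct1)
    then show "\<pi> \<in> optimal_plans \<sigma> \<alpha> \<beta>"
      unfolding \<open>\<pi> = ?V\<close> optimal_plans_def using coupling by blast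
  qed
qed

section \<open>Gaussian couplings with a quadratic log-density\<close>

text \<open>The candidate density with respect to \<open>gaussian a A \<Otimes>\<^sub>M gaussian b B\<close>. Multiplied by the two
  Gaussian densities it becomes proportional to the Gaussian density with mean \<open>(a, b)\<close> whose
  precision (inverse covariance) matrix has diagonal blocks \<open>P\<close>, \<open>Q\<close> and off-diagonal blocks \<open>- c\<close> times the
  identity; \<open>exp k\<close> is the normalizing factor.\<close>

definition tilt :: "real \<Rightarrow> real \<Rightarrow> real^'n \<Rightarrow> real^'n \<Rightarrow> real^'n^'n \<Rightarrow> real^'n^'n \<Rightarrow> real^'n^'n \<Rightarrow> real^'n^'n
    \<Rightarrow> (real^'n) \<times> (real^'n) \<Rightarrow> real" where
  "tilt k c a b A B P Q z = exp (k - (fst z - a) \<bullet> (P *v (fst z - a)) / 2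
     + c * ((fst z - a) \<bullet> (snd z - b)) - (snd z - b) \<bullet> (Q *v (snd z - b)) / 2
     + (fst z - a) \<bullet> (matrix_inv A *v (fst z - a)) / 2
     + (snd z - b) \<bullet> (matrix_inv B *v (snd z - b)) / 2)"

lemma borel_measurable_tilt[measurable]: "tilt k c a b A B P Q \<in> borel_measurable borel"
proof -
  have [measurable]: "fst \<in> borel \<rightarrow>\<^sub>M (borel :: (real^'n) measure)" "snd \<in> borel \<rightarrow>\<^sub>M (borel :: (real^'n) measure)"
    by (intro borel_measurable_continuous_onI continuous_intros)+
  show ?thesis unfolding tilt_def[abs_def] by measurable
qed

lemma tilt_swap: "tilt k c a b A B P Q (x, y) = tilt k c b a B A Q P (y, x)"
  unfolding tilt_def by (rule arg_cong[of _ _ exp]) (simp add: inner_commute)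

text \<open>Integrating out \<open>y\<close> leaves a Gaussian factor in \<open>x\<close> with exponent given by the Schur complement
  of \<open>Q\<close>; the hypothesis on \<open>P\<close> says that this complement is \<open>matrix_inv A\<close>, so everything cancels.\<close>

lemma nn_integral_tilt_snd:
  assumes "pos_def B" "pos_def Q"
    and P: "P = matrix_inv A + c\<^sup>2 *\<^sub>R matrix_inv Q"
    and k: "exp k = sqrt (det B * det Q)"
  shows "(\<integral>\<^sup>+y. ennreal (tilt k c a b A B P Q (x, y)) \<partial>gaussian b B) = 1"
proof -
  define u where "u = x - a"
  have uP: "u \<bullet> (P *v u) = u \<bullet> (matrix_inv A *v u) + c\<^sup>2 * (u \<bullet> (matrix_inv Q *v u))"
    unfolding P by (simp add: matrix_vector_mult_add_rdistrib scaleR_matrix_vector_assoc[symmetric] inner_add_right)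
  let ?k = "k - u \<bullet> (P *v u) / 2 + u \<bullet> (matrix_inv A *v u) / 2"
  have "(\<integral>\<^sup>+y. ennreal (tilt k c a b A B P Q (x, y)) \<partial>gaussian b B)
    = (\<integral>\<^sup>+y. ennreal (exp (?k - (y - b) \<bullet> (Q *v (y - b)) / 2 + (y - b) \<bullet> (c *\<^sub>R u)
        + (y - b) \<bullet> (matrix_inv B *v (y - b)) / 2)) \<partial>gaussian b B)"
    unfolding tilt_def u_def
    by (intro nn_integral_cong arg_cong[of _ _ ennreal] arg_cong[of _ _ exp]) (simp add: inner_commute)
  also have "\<dots> = ennreal (exp (?k + (c *\<^sub>R u) \<bullet> (matrix_inv Q *v (c *\<^sub>R u)) / 2) / sqrt (det B * det Q))"
    by (rule gaussian_tilt_integral[OF assms(1,2)])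
  also have "?k + (c *\<^sub>R u) \<bullet> (matrix_inv Q *v (c *\<^sub>R u)) / 2 = k"
    by (simp add: uP matrix_vector_mult_scaleR power2_eq_square)
  finally show ?thesis unfolding k[symmetric] by simp
qed

lemma tilt_coupling:
  assumes "pos_def A" "pos_def B" "pos_def P" "pos_def Q"
    and P: "P = matrix_inv A + c\<^sup>2 *\<^sub>R matrix_inv Q" and Q: "Q = matrix_inv B + c\<^sup>2 *\<^sub>R matrix_inv P"
    and k: "exp k = sqrt (det A * det P)" "exp k = sqrt (det B * det Q)"
  shows "density (gaussian a A \<Otimes>\<^sub>M gaussian b B) (tilt k c a b A B P Q) \<in> couplings (gaussian a A) (gaussian b B)"
proof -
  let ?\<alpha> = "gaussian a A" and ?\<beta> = "gaussian b B"
  let ?R = "tilt k c a b A B P Q"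
  interpret A: prob_space ?\<alpha> by (rule prob_space_gaussian) fact
  interpret B: prob_space ?\<beta> by (rule prob_space_gaussian) fact
  interpret AB: pair_prob_space ?\<alpha> ?\<beta> by unfold_locales
  let ?V = "density (?\<alpha> \<Otimes>\<^sub>M ?\<beta>) ?R"
  have s: "sets (?\<alpha> \<Otimes>\<^sub>M ?\<beta>) = sets borel"
    using sets_pair_measure_cong[OF sets_gaussian[of a A] sets_gaussian[of b B]] unfolding borel_prod .
  have [measurable]: "?R \<in> borel_measurable (?\<alpha> \<Otimes>\<^sub>M ?\<beta>)"
    unfolding measurable_cong_sets[OF s refl] by measurable
  have mf: "fst \<in> ?V \<rightarrow>\<^sub>M borel" and ms: "snd \<in> ?V \<rightarrow>\<^sub>M borel" by measurable
  have 1: "distr ?V borel fst = ?\<alpha>"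
  proof (rule measure_eqI)
    fix X assume "X \<in> sets (distr ?V borel fst)"
    then have X[measurable]: "X \<in> sets borel" by simp
    have "emeasure (distr ?V borel fst) X = (\<integral>\<^sup>+z. indicator X z \<partial>distr ?V borel fst)" by simp
    also have "\<dots> = (\<integral>\<^sup>+z. indicator X (fst z) \<partial>?V)"
      using mf by (subst nn_integral_distr) auto
    also have "\<dots> = (\<integral>\<^sup>+z. ennreal (?R z) * indicator X (fst z) \<partial>(?\<alpha> \<Otimes>\<^sub>M ?\<beta>))"
      by (subst nn_integral_density) auto
    also have "\<dots> = (\<integral>\<^sup>+x. \<integral>\<^sup>+y. ennreal (?R (x, y)) * indicator X x \<partial>?\<beta> \<partial>?\<alpha>)"
      by (subst B.nn_integral_fst[symmetric]) auto
    also have "\<dots> = (\<integral>\<^sup>+x. (\<integral>\<^sup>+y. ennreal (?R (x, y)) \<partial>?\<beta>) * indicator X x \<partial>?\<alpha>)"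
      by (intro nn_integral_cong nn_integral_multc) measurable
    also have "\<dots> = (\<integral>\<^sup>+x. indicator X x \<partial>?\<alpha>)"
      by (simp add: nn_integral_tilt_snd[OF assms(2,4) P k(2)])
    finally show "emeasure (distr ?V borel fst) X = emeasure ?\<alpha> X" by simp
  qed simp
  have 2: "distr ?V borel snd = ?\<beta>"
  proof (rule measure_eqI)
    fix X assume "X \<in> sets (distr ?V borel snd)"
    then have X[measurable]: "X \<in> sets borel" by simp
    have "emeasure (distr ?V borel snd) X = (\<integral>\<^sup>+z. indicator X z \<partial>distr ?V borel snd)" by simp
    also have "\<dots> = (\<integral>\<^sup>+z. indicator X (snd z) \<partial>?V)"
      using ms by (subst nn_integral_distr) auto
    also have "\<dots> = (\<integral>\<^sup>+z. ennreal (?R z) * indicator X (snd z) \<partial>(?\<alpha> \<Otimes>\<^sub>M ?\<beta>))"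
      by (subst nn_integral_density) auto
    also have "\<dots> = (\<integral>\<^sup>+y. \<integral>\<^sup>+x. ennreal (?R (x, y)) * indicator X y \<partial>?\<alpha> \<partial>?\<beta>)"
      by (subst AB.nn_integral_snd[symmetric]) (auto simp: case_prod_unfold)
    also have "\<dots> = (\<integral>\<^sup>+y. (\<integral>\<^sup>+x. ennreal (?R (x, y)) \<partial>?\<alpha>) * indicator X y \<partial>?\<beta>)"
      by (intro nn_integral_cong nn_integral_multc) measurable
    also have "\<dots> = (\<integral>\<^sup>+y. indicator X y \<partial>?\<beta>)"
      by (simp add: tilt_swap[of k c a b A B P Q] nn_integral_tilt_snd[OF assms(1,3) Q k(1)])
    finally show "emeasure (distr ?V borel snd) X = emeasure ?\<beta> X" by simp
  qed simp
  have "prob_space (distr ?V borel fst)" unfolding 1 by (rule A.prob_space_axioms)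
  then have "prob_space ?V" using mf by (rule prob_space_distrD[rotated])
  then show ?thesis using 1 2 s by (simp add: couplings_def)
qed

text \<open>The quadratic form of the precision matrix splits into the form of the Schur complement
  \<open>matrix_inv A\<close> of \<open>Q\<close> in \<open>x\<close> and the form of \<open>Q\<close> in a shifted \<open>y\<close>.\<close>

lemma block_precision_pos_def:
  fixes A P Q :: "real^'n^'n"
  assumes A: "pos_def A" and P: "pos_def P" and Q: "pos_def Q" and eq: "P = matrix_inv A + c\<^sup>2 *\<^sub>R matrix_inv Q"
  shows "pos_def (block_mat P (- c *\<^sub>R mat 1) (- c *\<^sub>R mat 1) Q)"
    and "z \<bullet> (block_mat P (- c *\<^sub>R mat 1) (- c *\<^sub>R mat 1) Q *v z)
      = fst (split_vec z) \<bullet> (P *v fst (split_vec z)) - 2 * c * (fst (split_vec z) \<bullet> snd (split_vec z))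
        + snd (split_vec z) \<bullet> (Q *v snd (split_vec z))"
proof -
  let ?N = "block_mat P (- c *\<^sub>R mat 1) (- c *\<^sub>R mat 1) Q"
  have tr: "transpose (- c *\<^sub>R mat 1 :: real^'n^'n) = - c *\<^sub>R mat 1"
    by (auto simp: transpose_def mat_def vec_eq_iff)
  have symP: "transpose P = P" and symQ: "transpose Q = Q" using P Q by (auto simp: pos_def_def)
  have scal: "- (c *\<^sub>R mat 1 :: real^'n^'n) *v v = - (c *\<^sub>R v)" for v
    using scaleR_matrix_vector_assoc[of "- c" "mat 1 :: real^'n^'n" v] by simp
  have quad: "z \<bullet> (?N *v z) = fst (split_vec z) \<bullet> (P *v fst (split_vec z))
      - 2 * c * (fst (split_vec z) \<bullet> snd (split_vec z)) + snd (split_vec z) \<bullet> (Q *v snd (split_vec z))" for z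
    by (simp add: inner_sum_vec split_vec_block_mat_mult inner_add_right inner_diff_right
        scal inner_commute)
  have "0 < z \<bullet> (?N *v z)" if "z \<noteq> 0" for z
  proof -
    obtain x y where xy: "split_vec z = (x, y)" by fastforce
    \<comment> \<open>The minimizer of the form over \<open>y\<close> for fixed \<open>x\<close> is subtracted, which decouples the two variables.\<close>
    define w where "w = y - c *\<^sub>R (matrix_inv Q *v x)"
    have QQ: "Q *v (matrix_inv Q *v x) = x"
      using invertible_matrix_inv[OF pos_def_invertible[OF Q]] by (simp add: matrix_vector_mul_assoc)
    have "w \<bullet> (Q *v w) = y \<bullet> (Q *v y) - 2 * c * (x \<bullet> y) + c\<^sup>2 * (x \<bullet> (matrix_inv Q *v x))"
      using inner_matrix_symmetric[OF symQ, of "matrix_inv Q *v x" y]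
      by (simp add: w_def matrix_vector_mult_diff_distrib matrix_vector_mult_scaleR QQ inner_simps
          inner_commute power2_eq_square algebra_simps)
    moreover have "x \<bullet> (P *v x) = x \<bullet> (matrix_inv A *v x) + c\<^sup>2 * (x \<bullet> (matrix_inv Q *v x))"
      by (subst eq) (simp add: matrix_vector_mult_add_rdistrib scaleR_matrix_vector_assoc[symmetric]
        inner_add_right)
    ultimately have eq2: "z \<bullet> (?N *v z) = x \<bullet> (matrix_inv A *v x) + w \<bullet> (Q *v w)"
      using quad[of z] xy by simp
    have Ai: "pos_def (matrix_inv A)" by (rule pos_def_matrix_inv[OF A])
    have nn: "0 \<le> x \<bullet> (matrix_inv A *v x)" "0 \<le> w \<bullet> (Q *v w)"
      using pos_def_imp_psd[OF Ai] pos_def_imp_psd[OF Q] by (auto simp: pos_semidef_def)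
    show ?thesis
    proof (cases "x = 0")
      case True
      then have "w = y" by (simp add: w_def)
      have "y \<noteq> 0"
      proof
        assume "y = 0"
        then have "split_vec z = split_vec 0" using True xy by (simp add: split_vec_def vec_eq_iff)
        then show False using that by (simp add: split_vec_eq_iff)
      qed
      then have "0 < w \<bullet> (Q *v w)" using Q \<open>w = y\<close> by (simp add: pos_def_def)
      then show ?thesis using eq2 nn by simp
    next
      case False
      then have "0 < x \<bullet> (matrix_inv A *v x)" using Ai by (simp add: pos_def_def)
      then show ?thesis using eq2 nn by simp
    qed
  qed
  then show "pos_def ?N"
    by (simp add: pos_def_def transpose_block_mat tr[simplified] symP symQ)
  show "z \<bullet> (?N *v z) = fst (split_vec z) \<bullet> (P *v fst (split_vec z))
      - 2 * c * (fst (split_vec z) \<bullet> snd (split_vec z)) + snd (split_vec z) \<bullet> (Q *v snd (split_vec z))"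
    by (rule quad)
qed

lemma gaussian_prod_eq_tilt:
  fixes A B P Q :: "real^'n^'n"
  assumes A: "pos_def A" and B: "pos_def B" and P: "pos_def P" and Q: "pos_def Q"
    and eq: "P = matrix_inv A + c\<^sup>2 *\<^sub>R matrix_inv Q"
    and inv: "matrix_inv (block_mat P (- c *\<^sub>R mat 1) (- c *\<^sub>R mat 1) Q) = \<Sigma>"
    and prob: "prob_space (density (gaussian a A \<Otimes>\<^sub>M gaussian b B) (tilt k c a b A B P Q))"
  shows "gaussian_prod (join_vec a b) \<Sigma> = density (gaussian a A \<Otimes>\<^sub>M gaussian b B) (tilt k c a b A B P Q)"
proof -
  let ?N = "block_mat P (- c *\<^sub>R mat 1) (- c *\<^sub>R mat 1) Q"
  have N: "pos_def ?N" using block_precision_pos_def(1)[OF A P Q eq] .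
  have \<Sigma>: "pos_def \<Sigma>" "matrix_inv \<Sigma> = ?N"
    using pos_def_matrix_inv[OF N] inv by auto
  define q where "q z = exp (- ((fst z - a) \<bullet> (P *v (fst z - a))) / 2
     + c * ((fst z - a) \<bullet> (snd z - b)) - (snd z - b) \<bullet> (Q *v (snd z - b)) / 2)" for z
  have [measurable]: "fst \<in> borel \<rightarrow>\<^sub>M (borel :: (real^'n) measure)" "snd \<in> borel \<rightarrow>\<^sub>M (borel :: (real^'n) measure)"
    by (intro borel_measurable_continuous_onI continuous_intros)+
  have [measurable]: "q \<in> borel_measurable borel"
    unfolding q_def[abs_def] by measurable
  define c1 where "c1 = 1 / sqrt ((2 * pi) ^ CARD('n + 'n) * det \<Sigma>)"
  have G: "gaussian_prod (join_vec a b) \<Sigma> = density lborel (\<lambda>z. ennreal c1 * ennreal (q z))"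
  proof -
    have "exp (- ((join_vec (fst z) (snd z) - join_vec a b) \<bullet> (?N *v (join_vec (fst z) (snd z) - join_vec a b))) / 2) = q z" for z
      unfolding block_precision_pos_def(2)[OF A P Q eq]
      by (simp add: split_vec_diff q_def field_simps)
    moreover have "ennreal (q z / sqrt ((2 * pi) ^ CARD('n + 'n) * det \<Sigma>)) = ennreal c1 * ennreal (q z)" for z
      by (simp add: c1_def q_def ennreal_mult''[symmetric])
    ultimately show ?thesis
      unfolding gaussian_prod_density \<Sigma>(2) by simp
  qed
  let ?nA = "\<lambda>x. exp (- ((x - a) \<bullet> (matrix_inv A *v (x - a))) / 2) / sqrt ((2 * pi) ^ CARD('n) * det A)"
  let ?nB = "\<lambda>x. exp (- ((x - b) \<bullet> (matrix_inv B *v (x - b))) / 2) / sqrt ((2 * pi) ^ CARD('n) * det B)"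
  define c2 where "c2 = exp k / (sqrt ((2 * pi) ^ CARD('n) * det A) * sqrt ((2 * pi) ^ CARD('n) * det B))"
  have dA: "0 < det A" and dB: "0 < det B" using A B det_pos_def_pos by auto
  have "gaussian a A \<Otimes>\<^sub>M gaussian b B = density (lborel \<Otimes>\<^sub>M lborel) (\<lambda>(x, y). ennreal (?nA x) * ennreal (?nB y))"
    unfolding gaussian_def
  proof (rule pair_measure_density)
    show "sigma_finite_measure (density lborel (\<lambda>x. ennreal (?nB x)))"
      using prob_space_imp_sigma_finite[OF prob_space_gaussian[OF B, of b]] by (simp add: gaussian_def)
  qed (auto intro: sigma_finite_lborel)
  also have "lborel \<Otimes>\<^sub>M lborel = (lborel :: ((real^'n) \<times> (real^'n)) measure)" by (rule lborel_prod)
  finally have AB: "gaussian a A \<Otimes>\<^sub>M gaussian b B = density lborel (\<lambda>(x, y). ennreal (?nA x) * ennreal (?nB y))" .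
  have V: "density (gaussian a A \<Otimes>\<^sub>M gaussian b B) (tilt k c a b A B P Q) = density lborel (\<lambda>z. ennreal c2 * ennreal (q z))"
  proof -
    have "?nA (fst z) * ?nB (snd z) * tilt k c a b A B P Q z = c2 * q z" for z
    proof -
      have "exp (- ((fst z - a) \<bullet> (matrix_inv A *v (fst z - a))) / 2) *
        exp (- ((snd z - b) \<bullet> (matrix_inv B *v (snd z - b))) / 2) * tilt k c a b A B P Q z = exp k * q z"
        unfolding tilt_def q_def exp_add[symmetric] by (rule arg_cong[of _ _ exp]) (simp add: field_simps)
      then show ?thesis by (simp add: c2_def field_simps)
    qed
    moreover have "0 \<le> tilt k c a b A B P Q z" "0 \<le> q z" for z by (simp_all add: tilt_def q_def)
    moreover have "0 \<le> ?nB y" for y using dB by simp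
    moreover have "ennreal p * ennreal p' * ennreal r = ennreal r' * ennreal t"
      if "p * p' * r = r' * t" "0 \<le> p'" "0 \<le> r" "0 \<le> t" for p p' r r' t :: real
      using that by (metis ennreal_mult'')
    ultimately have "(case z of (x, y) \<Rightarrow> ennreal (?nA x) * ennreal (?nB y)) * ennreal (tilt k c a b A B P Q z)
        = ennreal c2 * ennreal (q z)" for z
      unfolding case_prod_unfold by blast
    then show ?thesis unfolding AB by (subst density_density_eq) (auto simp: case_prod_unfold)
  qed
  \<comment> \<open>Both sides are probability measures with densities proportional to \<open>q\<close>.\<close>
  have "c1 = c2"
  proof (rule prob_density_eq_normalized[where M=lborel and q="\<lambda>z. ennreal (q z)"])
    have "prob_space (distr (gaussian (join_vec a b) \<Sigma>) borel split_vec)"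
      by (rule prob_space.prob_space_distr[OF prob_space_gaussian[OF \<Sigma>(1)]]) measurable
    then show "prob_space (density lborel (\<lambda>z. ennreal c1 * ennreal (q z)))"
      unfolding G[symmetric] gaussian_prod_def .
    show "prob_space (density lborel (\<lambda>z. ennreal c2 * ennreal (q z)))"
      using prob unfolding V .
    show "0 \<le> c1" using det_pos_def_pos[OF \<Sigma>(1)] by (simp add: c1_def)
    show "0 \<le> c2" using dA dB by (simp add: c2_def)
  qed measurable
  then show ?thesis using G V by simp
qed

section \<open>Entropic transport between Gaussian laws\<close>

theorem theorem1:
  fixes \<sigma> :: real and A B :: "real^'d^'d" and a b :: "real^'d"
  assumes "\<sigma> > 0" and "pos_def A" and "pos_def B"
  shows "OT \<sigma> (gaussian a A) (gaussian b B) = ereal ((norm (a - b))\<^sup>2 + bures_sq \<sigma> A B)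
    \<and> optimal_plans \<sigma> (gaussian a A) (gaussian b B) =
        {gaussian_prod (join_vec a b)
          (block_mat A (C_mat \<sigma> A B) (transpose (C_mat \<sigma> A B)) B)}"
proof -
  define s where "s = \<sigma>\<^sup>2"
  have s: "0 < s" and s2: "\<sigma> ^ 4 = s * s" using assms(1) by (auto simp: s_def power2_eq_square power4_eq_xxxx)
  define c where "c = 1 / s"
  have cs: "c * s = 1" "s * c = 1" "0 < c" using s by (auto simp: c_def)
  define S where "S = msqrt A"
  define T where "T = matrix_inv S"
  have S: "pos_def S" "S ** S = A" using msqrt_pos_def[OF assms(2)] by (auto simp: S_def)
  have symS: "transpose S = S" and invS: "invertible S"
    using S pos_def_invertible by (auto simp: pos_def_def)
  have T: "pos_def T" unfolding T_def by (rule pos_def_matrix_inv[OF S(1)])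
  have symT: "transpose T = T" and invT: "invertible T" using T pos_def_invertible by (auto simp: pos_def_def)
  have ST: "S ** T = mat 1" "T ** S = mat 1" unfolding T_def using invertible_matrix_inv[OF invS] by auto
  define X where "X = S ** B ** S"
  have X: "pos_def X" unfolding X_def by (rule pos_def_congruence[OF assms(3) symS invS])
  define D where "D = D_mat \<sigma> A B"
  have "pos_def (4 *\<^sub>R X + (s * s) *\<^sub>R mat 1)"
    using s by (intro pos_def_add_psd pos_def_imp_psd pos_def_scaled_identity pos_def_scaleR X) auto
  from msqrt_pos_def[OF this] have D: "pos_def D" "D ** D = 4 *\<^sub>R X + (s * s) *\<^sub>R mat 1"
    by (auto simp: D_def D_mat_def X_def S_def s2)
  have symD: "transpose D = D" using D by (simp add: pos_def_def)
  \<comment> \<open>The matrices \<open>E = (D - s) / 2\<close> and \<open>F = (D + s) / 2\<close> commute, differ by \<open>s\<close> and have product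
    \<open>X\<close>, since \<open>D\<^sup>2 = 4 X + s\<^sup>2\<close>. All matrices below are expressed through \<open>S\<close>, \<open>E\<close>, \<open>F\<close> and inverses.\<close>
  define E where "E = (1/2) *\<^sub>R D - (s/2) *\<^sub>R mat 1"
  define F where "F = E + s *\<^sub>R mat 1"
  have FD: "F = (1/2) *\<^sub>R (D + s *\<^sub>R mat 1)"
    by (simp add: F_def E_def vec_eq_iff field_simps)
  have Ev: "E *v x = (1/2) *\<^sub>R (D *v x) - (s/2) *\<^sub>R x" and Fv: "F *v x = E *v x + s *\<^sub>R x" for x
    by (simp_all add: E_def F_def matrix_vector_mult_diff_rdistrib matrix_vector_mult_add_rdistrib
        scaleR_matrix_vector_assoc[symmetric])
  have DDv: "D *v (D *v x) = 4 *\<^sub>R (X *v x) + (s * s) *\<^sub>R x" for x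
    using arg_cong[OF D(2), of "\<lambda>M. M *v x"]
    by (simp add: matrix_vector_mul_assoc matrix_vector_mult_add_rdistrib scaleR_matrix_vector_assoc[symmetric])
  have EFv: "E *v (F *v x) = X *v x" for x
    by (simp only: Fv Ev matrix_vector_right_distrib matrix_vector_mult_diff_distrib
        matrix_vector_mult_scaleR DDv) (simp add: vec_eq_iff field_simps)
  have FEv: "F *v (E *v x) = X *v x" for x
    using EFv[of x] by (simp add: Fv matrix_vector_right_distrib matrix_vector_mult_scaleR)
  have EF: "E ** F = X" by (simp add: matrix_eq matrix_vector_mul_assoc[symmetric] EFv)
  have symE: "transpose E = E"
    using symD by (simp add: E_def transpose_def vec_eq_iff mat_def eq_commute)
  have E: "pos_def E"
  proof (rule pos_def_of_shifted_square[OF symE X _ _ s])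
    show "E ** (E + s *\<^sub>R mat 1) = X" using EF by (simp add: F_def)
    have "E + (s/2) *\<^sub>R mat 1 = (1/2) *\<^sub>R D" by (simp add: E_def)
    then show "pos_semidef (E + (s/2) *\<^sub>R mat 1)"
      using pos_def_imp_psd[OF pos_def_scaleR[OF D(1), of "1/2"]] by simp
  qed
  have F: "pos_def F" unfolding F_def
    by (intro pos_def_add_psd E pos_def_imp_psd pos_def_scaled_identity s)
  define Ei where "Ei = matrix_inv E"
  define Fi where "Fi = matrix_inv F"
  have vE: "E *v (Ei *v x) = x" "Ei *v (E *v x) = x" for x
    using invertible_matrix_inv[OF pos_def_invertible[OF E]] by (auto simp: Ei_def matrix_vector_mul_assoc)
  have vF: "F *v (Fi *v x) = x" "Fi *v (F *v x) = x" for x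
    using invertible_matrix_inv[OF pos_def_invertible[OF F]] by (auto simp: Fi_def matrix_vector_mul_assoc)
  have vS: "S *v (T *v x) = x" "T *v (S *v x) = x" for x
    using ST by (auto simp: matrix_vector_mul_assoc)
  have vA: "A *v x = S *v (S *v x)" for x by (simp add: S(2)[symmetric] matrix_vector_mul_assoc)
  have vB: "B *v x = T *v (E *v (F *v (T *v x)))" for x
  proof -
    have "T *v (X *v (T *v x)) = B *v x" unfolding X_def
      by (simp add: matrix_vector_mul_assoc[symmetric] vS)
    then show ?thesis by (simp add: EFv)
  qed
  \<comment> \<open>Matrix identities are checked by their action on vectors: with these rules every product
    becomes nested application, where inverse pairs cancel by rewriting.\<close>
  note mv = matrix_vector_mul_assoc[symmetric] matrix_vector_mult_add_rdistrib matrix_vector_mult_diff_rdistrib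
    scaleR_matrix_vector_assoc[symmetric] matrix_vector_right_distrib matrix_vector_mult_diff_distrib
    matrix_vector_mult_scaleR
  have C: "C_mat \<sigma> A B = S ** E ** T"
    by (simp add: matrix_eq C_mat_def S_def[symmetric] D_def[symmetric] T_def[symmetric] s_def[symmetric]
        mv Ev vS)
  have Ct: "transpose (S ** E ** T) = T ** E ** S"
    by (simp add: matrix_transpose_mul symS symT symE matrix_mul_assoc)
  \<comment> \<open>Diagonal blocks of the precision matrix of the candidate plan; with the off-diagonal blocks
    \<open>- c\<close> they reproduce the cross term of \<open>- |x - y|\<^sup>2 / (2 \<sigma>\<^sup>2)\<close>, because \<open>c = 1 / \<sigma>\<^sup>2\<close>.\<close>
  define P where "P = c *\<^sub>R (T ** F ** T)"
  define Q where "Q = c *\<^sub>R (S ** Ei ** S)"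
  have Ei: "pos_def Ei" unfolding Ei_def by (rule pos_def_matrix_inv[OF E])
  have P: "pos_def P" unfolding P_def using cs by (intro pos_def_scaleR pos_def_congruence F symT invT)
  have Q: "pos_def Q" unfolding Q_def using cs by (intro pos_def_scaleR pos_def_congruence Ei symS invS)
  have iA: "matrix_inv A = T ** T"
    by (rule matrix_inv_eqI) (simp add: matrix_eq mv vA vS)
  have iB: "matrix_inv B = S ** Fi ** Ei ** S"
    by (rule matrix_inv_eqI) (simp add: matrix_eq mv vB vS vF vE)
  have iP: "matrix_inv P = s *\<^sub>R (S ** Fi ** S)"
    by (rule matrix_inv_eqI) (simp add: matrix_eq P_def mv vS vF cs)
  have iQ: "matrix_inv Q = s *\<^sub>R (T ** E ** T)"
    by (rule matrix_inv_eqI) (simp add: matrix_eq Q_def mv vS vE cs)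
  have ccs: "c\<^sup>2 * s = c" using cs by (simp add: power2_eq_square mult.assoc)
  have P': "P = matrix_inv A + c\<^sup>2 *\<^sub>R matrix_inv Q"
    unfolding matrix_eq by (simp add: iA iQ P_def mv Fv ccs cs scaleR_add_right add.commute)
  have Q': "Q = matrix_inv B + c\<^sup>2 *\<^sub>R matrix_inv P"
  proof -
    have "Ei *v y = Fi *v y + s *\<^sub>R (Fi *v (Ei *v y))" for y
    proof -
      have "Ei *v y = Fi *v (F *v (Ei *v y))" by (simp add: vF)
      also have "\<dots> = Fi *v y + s *\<^sub>R (Fi *v (Ei *v y))"
        by (simp only: Fv vE matrix_vector_right_distrib matrix_vector_mult_scaleR)
      finally show ?thesis .
    qed
    note e = this
    have "c *\<^sub>R (S *v (Ei *v y)) = S *v (Fi *v (Ei *v y)) + c *\<^sub>R (S *v (Fi *v y))" for y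
      by (subst e) (simp add: mv scaleR_add_right cs)
    then show ?thesis unfolding matrix_eq by (simp add: iB iP Q_def mv ccs)
  qed
  let ?\<Sigma> = "block_mat A (S ** E ** T) (T ** E ** S) B"
  have scal: "- (c *\<^sub>R mat 1 :: real^'d^'d) *v v = - (c *\<^sub>R v)" for v
    using scaleR_matrix_vector_assoc[of "- c" "mat 1 :: real^'d^'d" v] by simp
  have inv: "matrix_inv (block_mat P (- c *\<^sub>R mat 1) (- c *\<^sub>R mat 1) Q) = ?\<Sigma>"
  proof (rule block_mat_matrix_inv)
    show "P ** A + - c *\<^sub>R mat 1 ** (T ** E ** S) = mat 1"
      by (simp add: matrix_eq mv scal P_def vA vS Fv scaleR_add_right cs)
    show "P ** (S ** E ** T) + - c *\<^sub>R mat 1 ** B = 0"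
      by (simp add: matrix_eq mv scal P_def vB vS FEv EFv)
    show "- c *\<^sub>R mat 1 ** A + Q ** (T ** E ** S) = 0"
      by (simp add: matrix_eq mv scal Q_def vA vS vE)
    show "- c *\<^sub>R mat 1 ** (S ** E ** T) + Q ** B = mat 1"
      by (simp add: matrix_eq mv scal Q_def vB vS vE) (simp add: Fv mv vS scaleR_add_right cs)
  qed
  have trF: "trace F = trace D / 2 + s * CARD('d) / 2"
    unfolding FD by (simp add: trace_scaleR trace_add trace_I add_divide_distrib)
  have trPA: "trace (P ** A) = c * trace F"
  proof -
    have "P ** A = c *\<^sub>R (T ** (F ** S))" by (simp add: matrix_eq mv P_def vA vS)
    then have "trace (P ** A) = c * trace ((F ** S) ** T)"
      by (simp only: trace_scaleR trace_mul_sym[of T])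
    also have "(F ** S) ** T = F" by (simp add: matrix_eq mv vS)
    finally show ?thesis .
  qed
  have trQB: "trace (Q ** B) = c * trace F"
  proof -
    have "Q ** B = c *\<^sub>R (S ** (F ** T))" by (simp add: matrix_eq mv Q_def vB vS vE)
    then have "trace (Q ** B) = c * trace ((F ** T) ** S)"
      by (simp only: trace_scaleR trace_mul_sym[of S])
    also have "(F ** T) ** S = F" by (simp add: matrix_eq mv vS)
    finally show ?thesis .
  qed
  let ?n = "CARD('d)"
  define \<Delta> where "\<Delta> = det (D + s *\<^sub>R mat 1)"
  have dF: "det F = (1/2) ^ ?n * \<Delta>" unfolding FD \<Delta>_def by (rule det_scaleR)
  have \<Delta>: "0 < \<Delta>" using det_pos_def_pos[OF F] unfolding dF by (simp add: zero_less_mult_iff)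
  have dST: "det S * det T = 1" using ST(1) by (metis det_mul det_I)
  have "P ** A = c *\<^sub>R (T ** (F ** S))" by (simp add: matrix_eq mv P_def vA vS)
  then have "det P * det A = c ^ ?n * (det T * (det F * det S))"
    by (metis det_mul det_scaleR)
  then have dPA: "det A * det P = c ^ ?n * det F" using dST by (simp add: algebra_simps)
  have "Q ** B = c *\<^sub>R (S ** (F ** T))" by (simp add: matrix_eq mv Q_def vB vS vE)
  then have "det Q * det B = c ^ ?n * (det S * (det F * det T))"
    by (metis det_mul det_scaleR)
  then have dQB: "det B * det Q = c ^ ?n * det F" using dST by (simp add: algebra_simps)
  \<comment> \<open>The normalization forced by \<open>exp k = sqrt (det A * det P) = sqrt (det B * det Q)\<close>.\<close>
  define k where "k = (ln \<Delta> - ?n * ln (2 * s)) / 2"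
  have k: "exp k = sqrt (c ^ ?n * det F)"
  proof -
    have "ln ((2 * s) ^ ?n) = ?n * ln (2 * s)" by (rule ln_realpow)
    then have "(exp k)\<^sup>2 = exp (ln \<Delta> - ln ((2 * s) ^ ?n))"
      by (simp add: exp_double[symmetric] k_def del: ln_realpow)
    also have "\<dots> = \<Delta> / (2 * s) ^ ?n" using s \<Delta> by (simp add: exp_diff)
    also have "\<dots> = c ^ ?n * det F" by (simp add: dF c_def power_mult_distrib power_divide)
    finally show ?thesis by (metis exp_ge_zero real_sqrt_unique)
  qed
  let ?R = "tilt k c a b A B P Q"
  let ?V = "density (gaussian a A \<Otimes>\<^sub>M gaussian b B) ?R"
  have coup: "?V \<in> couplings (gaussian a A) (gaussian b B)"
    by (rule tilt_coupling[OF assms(2,3) P Q P' Q']) (simp_all only: k dPA dQB)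
  have gp: "gaussian_prod (join_vec a b) ?\<Sigma> = ?V"
    using coup by (intro gaussian_prod_eq_tilt[OF assms(2,3) P Q P' inv]) (simp add: couplings_def)
  \<comment> \<open>The entropic potentials, quadratic in the centred variables; the linear terms come from the
    difference of the means.\<close>
  define U where "U = mat 1 - s *\<^sub>R P + s *\<^sub>R matrix_inv A"
  define W where "W = mat 1 - s *\<^sub>R Q + s *\<^sub>R matrix_inv B"
  define f where "f x = ((norm (a - b))\<^sup>2 + 2 * s * k) + (2 *\<^sub>R (a - b)) \<bullet> (x - a) + (x - a) \<bullet> (U *v (x - a))" for x
  define g where "g y = (- 2 *\<^sub>R (a - b)) \<bullet> (y - b) + (y - b) \<bullet> (W *v (y - b))" for y
  have pot: "(norm (x - y))\<^sup>2 + 2 * \<sigma>\<^sup>2 * ln (?R (x, y)) = f x + g y" for x y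
  proof -
    define u v where "u = x - a" and "v = y - b"
    have xy: "x - y = (a - b) + (u - v)" by (simp add: u_def v_def)
    have n: "(norm (x - y))\<^sup>2 = (norm (a - b))\<^sup>2 + 2 * ((a - b) \<bullet> u) - 2 * ((a - b) \<bullet> v)
        + u \<bullet> u - 2 * (u \<bullet> v) + v \<bullet> v"
      unfolding xy power2_norm_eq_inner by (simp add: inner_simps inner_commute algebra_simps)
    have l: "2 * s * ln (?R (x, y)) = 2 * s * k - s * (u \<bullet> (P *v u)) + 2 * (u \<bullet> v)
        - s * (v \<bullet> (Q *v v)) + s * (u \<bullet> (matrix_inv A *v u)) + s * (v \<bullet> (matrix_inv B *v v))"
      unfolding tilt_def fst_conv snd_conv u_def[symmetric] v_def[symmetric]
      using s by (simp add: c_def field_simps)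
    have fu: "f x = (norm (a - b))\<^sup>2 + 2 * s * k + 2 * ((a - b) \<bullet> u) + u \<bullet> u - s * (u \<bullet> (P *v u))
        + s * (u \<bullet> (matrix_inv A *v u))"
      unfolding f_def u_def[symmetric] U_def
      by (simp add: matrix_vector_mult_add_rdistrib matrix_vector_mult_diff_rdistrib
        scaleR_matrix_vector_assoc[symmetric] inner_add_right inner_diff_right)
    have gv: "g y = - 2 * ((a - b) \<bullet> v) + v \<bullet> v - s * (v \<bullet> (Q *v v)) + s * (v \<bullet> (matrix_inv B *v v))"
      unfolding g_def v_def[symmetric] W_def
      by (simp add: matrix_vector_mult_add_rdistrib matrix_vector_mult_diff_rdistrib
        scaleR_matrix_vector_assoc[symmetric] inner_add_right inner_diff_right)
    show ?thesis unfolding s_def[symmetric] n l fu gv by simp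
  qed
  interpret GA: prob_space "gaussian a A" by (rule prob_space_gaussian) fact
  note lA = gaussian_linear_moment[OF assms(2), of a] and qA = gaussian_quadratic_moment[OF assms(2), of a]
  note lB = gaussian_linear_moment[OF assms(3), of b] and qB = gaussian_quadratic_moment[OF assms(3), of b]
  have f: "integrable (gaussian a A) f" unfolding f_def[abs_def]
    by (intro Bochner_Integration.integrable_add lA qA) auto
  have g: "integrable (gaussian b B) g" unfolding g_def[abs_def]
    by (intro Bochner_Integration.integrable_add lB qB)
  have If: "(\<integral>x. f x \<partial>gaussian a A) = (norm (a - b))\<^sup>2 + 2 * s * k + trace (U ** A)"
    unfolding f_def[abs_def] using lA qA GA.prob_space by simp
  have Ig: "(\<integral>y. g y \<partial>gaussian b B) = trace (W ** B)"
    unfolding g_def[abs_def] using lB qB by simp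
  have "U ** A = A - s *\<^sub>R (P ** A) + s *\<^sub>R mat 1"
    by (simp add: matrix_eq U_def mv iA vA vS)
  then have trU: "trace (U ** A) = trace A - trace F + s * ?n"
    using cs by (simp add: trace_add trace_sub trace_scaleR trPA trace_I mult.assoc[symmetric])
  have "W ** B = B - s *\<^sub>R (Q ** B) + s *\<^sub>R mat 1"
    by (simp add: matrix_eq W_def mv iB vB vS vE vF)
  then have trW: "trace (W ** B) = trace B - trace F + s * ?n"
    using cs by (simp add: trace_add trace_sub trace_scaleR trQB trace_I mult.assoc[symmetric])
  have val: "(\<integral>x. f x \<partial>gaussian a A) + (\<integral>y. g y \<partial>gaussian b B) = (norm (a - b))\<^sup>2 + bures_sq \<sigma> A B"
    unfolding If Ig trU trW bures_sq_def D_def[symmetric] s_def[symmetric] \<Delta>_def[symmetric] trF k_def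
    by (simp add: field_simps)
  have "0 < ?R z" for z by (simp add: tilt_def)
  note opt = entropic_potentials_optimal[OF prob_space_gaussian[OF assms(2)] sets_gaussian gaussian_second_moment[OF assms(2)]
    prob_space_gaussian[OF assms(3)] sets_gaussian gaussian_second_moment[OF assms(3)] assms(1) borel_measurable_tilt this coup f g pot]
  show ?thesis using opt unfolding val C Ct gp by simp
qed

end
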